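(* Let $\mathrm{st}$ be a bicompatible permutation statistic (i.e. one that is both shuffle-compatible and substring-compatible). Then either $\mathrm{st} \equiv \mathrm{Des}$, or $\mathrm{st} \equiv \mathrm{Pk}$, or $\mathrm{st} \equiv \mathrm{Val}$, or $\pi \sim_{\mathrm{st}} \sigma$ for all permutations $\pi$ and $\sigma$ with $|\pi| = |\sigma| \le 6$.
   Context: A permutation is a finite (possibly empty) sequence $\pi = \pi_1 \cdots \pi_n$ of distinct positive integers, called its letters; $|\pi| = n$ is its length. Permutations $\pi,\sigma$ of the same length have the same relative order if $\pi_i<\pi_j \iff \sigma_i<\sigma_j$ for all $i,j$. A permutation statistic is a function $\mathrm{st}$ defined on all permutations such that $\mathrm{st}(\pi) = \mathrm{st}(\sigma)$ whenever $\pi$ and $\sigma$ have the same relative order. Write $\pi \sim_{\mathrm{st}} \sigma$ if $|\pi| = |\sigma|$ and $\mathrm{st}(\pi) = \mathrm{st}(\sigma)$. Two statistics are equivalent, $\mathrm{st} \equiv \mathrm{st}'$, if the relations $\sim_{\mathrm{st}}$ and $\sim_{\mathrm{st}'}$ coincide. Permutations $\pi,\sigma$ are disjoint if they have no letters in common; then the shuffle set $\pi ⧢ \sigma$ is the set of all $\binom{|\pi|+|\sigma|}{|\pi|}$ permutations of length $|\pi|+|\sigma|$ containing both $\pi$ and $\sigma$ as subsequences. $\mathrm{st}$ is shuffle-compatible if for disjoint $\pi,\sigma$ the multiset $\{\mathrm{st}(\tau) : \tau \in \pi ⧢ \sigma\}$ depends only on $\mathrm{st}(\pi), \mathrm{st}(\sigma),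 |\pi|, |\sigma|$. $\mathrm{st}$ is substring-compatible if $\pi \sim_{\mathrm{st}} \sigma$ implies $\pi_i \cdots \pi_j \sim_{\mathrm{st}} \sigma_i \cdots \sigma_j$ for all $1 \le i \le j \le |\pi|$. For $\pi$ of length $n$: $\mathrm{Des}(\pi) = \{1 \le i \le n-1 : \pi_i > \pi_{i+1}\}$; $\mathrm{Pk}(\pi) = \{2 \le i \le n-1 : \pi_{i-1} < \pi_i > \pi_{i+1}\}$; $\mathrm{Val}(\pi) = \{2 \le i \le n-1 : \pi_{i-1} > \pi_i < \pi_{i+1}\}$. *)

theory Defs
  imports "HOL-Library.Multiset" "HOL-Library.Sublist"
begin

definition is_permutation :: "nat list \<Rightarrow> bool" where
  "is_permutation \<pi> \<longleftrightarrow> distinct \<pi> \<and> (\<forall>x\<in>set \<pi>. 0 < x)"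

definition same_relative_order :: "nat list \<Rightarrow> nat list \<Rightarrow> bool" where
  "same_relative_order \<pi> \<sigma> \<longleftrightarrow> length \<pi> = length \<sigma> \<and>
     (\<forall>i<length \<pi>. \<forall>j<length \<pi>. \<pi> ! i < \<pi> ! j \<longleftrightarrow> \<sigma> ! i < \<sigma> ! j)"

text \<open>
  A statistic is a total function on lists of naturals, of which only the values on
  permutations matter. All notions below are relativised to permutations.
\<close>

definition permutation_statistic :: "(nat list \<Rightarrow> 'a) \<Rightarrow> bool" where
  "permutation_statistic st \<longleftrightarrow>
     (\<forall>\<pi> \<sigma>. is_permutation \<pi> \<longrightarrow> is_permutation \<sigma> \<longrightarrow> same_relative_order \<pi> \<sigma> \<longrightarrow>
        st \<pi> = st \<sigma>)"

definition st_sim :: "(nat list \<Rightarrow> 'a) \<Rightarrow> nat list \<Rightarrow> nat list \<Rightarrow> bool" where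
  "st_sim st \<pi> \<sigma> \<longleftrightarrow> length \<pi> = length \<sigma> \<and> st \<pi> = st \<sigma>"

definition st_equiv :: "(nat list \<Rightarrow> 'a) \<Rightarrow> (nat list \<Rightarrow> 'b) \<Rightarrow> bool" where
  "st_equiv st st' \<longleftrightarrow>
     (\<forall>\<pi> \<sigma>. is_permutation \<pi> \<longrightarrow> is_permutation \<sigma> \<longrightarrow> (st_sim st \<pi> \<sigma> \<longleftrightarrow> st_sim st' \<pi> \<sigma>))"

definition disjoint_perms :: "nat list \<Rightarrow> nat list \<Rightarrow> bool" where
  "disjoint_perms \<pi> \<sigma> \<longleftrightarrow> is_permutation \<pi> \<and> is_permutation \<sigma> \<and> set \<pi> \<inter> set \<sigma> = {}"

text \<open>
  On disjoint permutations the library's \<^const>\<open>shuffles\<close> is the set of permutations of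
  length \<open>|\<pi>| + |\<sigma>|\<close> containing both as subsequences.
\<close>

lemma shuffles_eq_subseqs:
  assumes "disjoint_perms \<pi> \<sigma>"
  shows "shuffles \<pi> \<sigma> = {\<tau>. is_permutation \<tau> \<and> length \<tau> = length \<pi> + length \<sigma> \<and>
           subseq \<pi> \<tau> \<and> subseq \<sigma> \<tau>}" (is "_ = ?R")
proof (intro equalityI subsetI)
  fix \<tau> assume \<tau>: "\<tau> \<in> shuffles \<pi> \<sigma>"
  from assms have disj: "set \<pi> \<inter> set \<sigma> = {}" by (simp add: disjoint_perms_def)
  have "\<pi> = filter (\<lambda>x. x \<in> set \<pi>) \<tau>" "\<sigma> = filter (\<lambda>x. x \<notin> set \<pi>) \<tau>"
    using filter_shuffles_disjoint1[OF disj \<tau>] by simp_all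
  then have "subseq \<pi> \<tau>" "subseq \<sigma> \<tau>"
    by (metis subseq_filter_left)+
  moreover have "is_permutation \<tau>"
    using assms distinct_disjoint_shuffles[OF _ _ disj \<tau>] set_shuffles[OF \<tau>]
    by (auto simp: disjoint_perms_def is_permutation_def)
  ultimately show "\<tau> \<in> ?R" using length_shuffles[OF \<tau>] by simp
next
  fix \<tau> assume "\<tau> \<in> ?R"
  then have \<tau>: "distinct \<tau>" "length \<tau> = length \<pi> + length \<sigma>" "subseq \<pi> \<tau>" "subseq \<sigma> \<tau>"
    by (auto simp: is_permutation_def)
  let ?P = "\<lambda>x. x \<in> set \<pi>"
  from assms have disj: "set \<pi> \<inter> set \<sigma> = {}" by (simp add: disjoint_perms_def)
  have "subseq (filter ?P \<pi>) (filter ?P \<tau>)" "subseq (filter (\<lambda>x. \<not> ?P x) \<sigma>) (filter (\<lambda>x. \<not> ?P x) \<tau>)"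
    using \<tau>(3,4) by (simp_all only: subseq_filter)
  moreover have "filter ?P \<pi> = \<pi>" "filter (\<lambda>x. \<not> ?P x) \<sigma> = \<sigma>"
    using disj by (auto simp: filter_id_conv)
  ultimately have sub: "subseq \<pi> (filter ?P \<tau>)" "subseq \<sigma> (filter (\<lambda>x. \<not> ?P x) \<tau>)"
    by simp_all
  have "length (filter ?P \<tau>) + length (filter (\<lambda>x. \<not> ?P x) \<tau>) = length \<pi> + length \<sigma>"
    using \<tau> sum_length_filter_compl[of ?P \<tau>] by simp
  with sub have "length \<pi> = length (filter ?P \<tau>)" "length \<sigma> = length (filter (\<lambda>x. \<not> ?P x) \<tau>)"
    using list_emb_length[OF sub(1)] list_emb_length[OF sub(2)] by linarith+
  with sub have "\<pi> = filter ?P \<tau>" "\<sigma> = filter (\<lambda>x. \<not> ?P x) \<tau>"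
    using subseq_same_length by blast+
  then show "\<tau> \<in> shuffles \<pi> \<sigma>"
    using partition_in_shuffles[of \<tau> ?P] by simp
qed

definition shuffle_compatible :: "(nat list \<Rightarrow> 'a) \<Rightarrow> bool" where
  "shuffle_compatible st \<longleftrightarrow>
     (\<forall>\<pi> \<sigma> \<pi>' \<sigma>'. disjoint_perms \<pi> \<sigma> \<longrightarrow> disjoint_perms \<pi>' \<sigma>' \<longrightarrow>
        st \<pi> = st \<pi>' \<longrightarrow> st \<sigma> = st \<sigma>' \<longrightarrow> length \<pi> = length \<pi>' \<longrightarrow> length \<sigma> = length \<sigma>' \<longrightarrow>
        image_mset st (mset_set (shuffles \<pi> \<sigma>)) = image_mset st (mset_set (shuffles \<pi>' \<sigma>')))"

text \<open>The substring \<open>\<pi>\<^sub>i \<cdots> \<pi>\<^sub>j\<close> with 1-based indices \<open>1 \<le> i \<le> j \<le> |\<pi>|\<close>.\<close>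

definition substring :: "nat list \<Rightarrow> nat \<Rightarrow> nat \<Rightarrow> nat list" where
  "substring \<pi> i j = take (j - i + 1) (drop (i - 1) \<pi>)"

definition substring_compatible :: "(nat list \<Rightarrow> 'a) \<Rightarrow> bool" where
  "substring_compatible st \<longleftrightarrow>
     (\<forall>\<pi> \<sigma>. is_permutation \<pi> \<longrightarrow> is_permutation \<sigma> \<longrightarrow> st_sim st \<pi> \<sigma> \<longrightarrow>
        (\<forall>i j. 1 \<le> i \<longrightarrow> i \<le> j \<longrightarrow> j \<le> length \<pi> \<longrightarrow>
           st_sim st (substring \<pi> i j) (substring \<sigma> i j)))"

definition bicompatible :: "(nat list \<Rightarrow> 'a) \<Rightarrow> bool" where
  "bicompatible st \<longleftrightarrow> shuffle_compatible st \<and> substring_compatible st"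

text \<open>Positions are 1-based: the letter \<open>\<pi>\<^sub>i\<close> is \<open>\<pi> ! (i - 1)\<close>.\<close>

definition Des :: "nat list \<Rightarrow> nat set" where
  "Des \<pi> = {i. 1 \<le> i \<and> i \<le> length \<pi> - 1 \<and> \<pi> ! (i - 1) > \<pi> ! i}"

definition Pk :: "nat list \<Rightarrow> nat set" where
  "Pk \<pi> = {i. 2 \<le> i \<and> i \<le> length \<pi> - 1 \<and> \<pi> ! (i - 2) < \<pi> ! (i - 1) \<and> \<pi> ! (i - 1) > \<pi> ! i}"

definition Val :: "nat list \<Rightarrow> nat set" where
  "Val \<pi> = {i. 2 \<le> i \<and> i \<le> length \<pi> - 1 \<and> \<pi> ! (i - 2) > \<pi> ! (i - 1) \<and> \<pi> ! (i - 1) < \<pi> ! i}"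

end

theory Submission
  imports Defs
begin

text \<open>
  Equality of \<open>st\<close> on words of length 2 or 3 already decides which of the cases holds. If \<open>st\<close> separates
  12 from 21, it determines \<open>Des\<close>. Otherwise only three values \<open>a = st(123) = st(321)\<close>,
  \<open>b = st(132) = st(231)\<close>, \<open>c = st(213) = st(312)\<close> remain in length 3; \<open>b \<notin> {a, c}\<close> means that \<open>st\<close>
  determines \<open>Pk\<close>, and \<open>c \<notin> {a, b}\<close> is the complementary case \<open>Val\<close>. Conversely \<open>Des\<close> or \<open>Pk\<close> determines
  \<open>st\<close>, by induction on the length: delete a letter and replace it, using shuffle compatibility, by a
  letter larger than all others. There is at most one way (for \<open>Pk\<close>, at most two) to insert a maximal
  letter so that a prescribed set results.

  If all words of length below \<open>n\<close> are equivalent, the number of words of a fixed class in a shuffle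
  of words of lengths \<open>a\<close> and \<open>n - a\<close> is a constant \<open>N a\<close>. Associativity of shuffles relates the constants: for
  \<open>n = 6\<close>, \<open>5 N 1 = 2 N 2\<close> and \<open>10 N 1 = 3 N 3\<close>, whence 6 divides \<open>N 1 \<le> 6\<close> and the class is everything. For
  \<open>n = 4\<close> only \<open>N 1 = 2\<close>, \<open>N 2 = 3\<close> and for \<open>n = 5\<close> only \<open>N 1 \<in> {1, 2}\<close> survive such counting (also applied to
  pairs of overlapping windows); the remaining finitely many configurations are excluded by
  explicit case trees whose leaves are violated counts.
\<close>

section \<open>Shuffles and words determined by a statistic\<close>

definition insert_at :: "nat \<Rightarrow> 'a \<Rightarrow> 'a list \<Rightarrow> 'a list" where
  "insert_at k x v = take k v @ x # drop k v"

lemma length_insert_at [simp]: "length (insert_at k x v) = Suc (length v)"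
  by (simp add: insert_at_def)

lemma nth_insert_at:
  assumes "k \<le> length v"
  shows "insert_at k x v ! i = (if i < k then v ! i else if i = k then x else v ! (i - 1))"
  using assms by (auto simp: insert_at_def nth_append min_def nth_Cons' not_less)

lemma insert_at_0 [simp]: "insert_at 0 x v = x # v"
  by (simp add: insert_at_def)

lemma shuffles_single: "shuffles [x] v = (\<lambda>k. insert_at k x v) ` {..length v}"
proof (induction v)
  case Nil
  then show ?case by (simp add: insert_at_def)
next
  case (Cons y v)
  have "{..length (y # v)} = insert 0 (Suc ` {..length v})"
    by (simp add: atMost_Suc_eq_insert_0)
  then show ?case
    by (simp add: Cons image_image insert_at_def)
qed

lemma insert_at_in_shuffles: "k \<le> length v \<Longrightarrow> insert_at k x v \<in> shuffles [x] v"
  by (auto simp: shuffles_single)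

lemma shuffles_Cons: "x # v \<in> shuffles [x] v"
  using insert_at_in_shuffles[of 0 v x] by simp

lemma shuffles_swap: "y # x # v \<in> shuffles [x] (y # v)"
  using insert_at_in_shuffles[of 1 "y # v" x] by (simp add: insert_at_def)

lemma shuffles_snoc: "v @ [x] \<in> shuffles [x] v"
  using insert_at_in_shuffles[of "length v" v x] by (simp add: insert_at_def)

lemma is_permutation_Cons:
  "is_permutation (x # v) \<longleftrightarrow> 0 < x \<and> x \<notin> set v \<and> is_permutation v"
  by (auto simp: is_permutation_def)

lemma is_permutation_take: "is_permutation v \<Longrightarrow> is_permutation (take k v)"
  by (auto simp: is_permutation_def dest: in_set_takeD)

lemma is_permutation_drop: "is_permutation v \<Longrightarrow> is_permutation (drop k v)"
  by (auto simp: is_permutation_def dest: in_set_dropD)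

lemma disjoint_perms_append: "disjoint_perms u w \<longleftrightarrow> is_permutation (u @ w)"
  by (auto simp: disjoint_perms_def is_permutation_def)

lemma disjoint_perms_single: "disjoint_perms [x] v \<longleftrightarrow> is_permutation (x # v)"
  by (simp add: disjoint_perms_append)

lemma shuffles_permutation:
  assumes "disjoint_perms u w" "\<tau> \<in> shuffles u w"
  shows "is_permutation \<tau>" "length \<tau> = length u + length w"
  using assms shuffles_eq_subseqs by auto

text \<open>The inserted 0 gives \<open>Max\<close> a value on the empty word, and the successor
  makes the bound positive, so that it is a legal letter.\<close>

definition above :: "nat list \<Rightarrow> nat" where
  "above v = Suc (Max (insert 0 (set v)))"

lemma above_greater: "x \<in> set v \<Longrightarrow> x < above v"
  by (simp add: above_def less_Suc_eq_le)

lemma above_notin: "above v \<notin> set v"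
  using above_greater by blast

lemma disjoint_perms_above: "is_permutation v \<Longrightarrow> disjoint_perms [above v] v"
  by (auto simp: disjoint_perms_single is_permutation_Cons above_notin) (simp add: above_def)

locale bicompatible_statistic =
  fixes st :: "nat list \<Rightarrow> 'a"
  assumes statistic: "permutation_statistic st"
    and bicompatible: "bicompatible st"
begin

definition determines :: "nat \<Rightarrow> (nat list \<Rightarrow> 'b) \<Rightarrow> bool" where
  "determines n F \<longleftrightarrow> (\<forall>\<pi> \<sigma>. is_permutation \<pi> \<longrightarrow> is_permutation \<sigma> \<longrightarrow> length \<pi> = n \<longrightarrow> length \<sigma> = n \<longrightarrow>
     st \<pi> = st \<sigma> \<longrightarrow> F \<pi> = F \<sigma>)"

definition trivial_on :: "nat \<Rightarrow> bool" where
  "trivial_on n \<longleftrightarrow> (\<forall>\<pi> \<sigma>. is_permutation \<pi> \<longrightarrow> is_permutation \<sigma> \<longrightarrow> length \<pi> = n \<longrightarrow> length \<sigma> = n \<longrightarrow>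
     st \<pi> = st \<sigma>)"

lemma st_order:
  "is_permutation \<pi> \<Longrightarrow> is_permutation \<sigma> \<Longrightarrow> same_relative_order \<pi> \<sigma> \<Longrightarrow> st \<pi> = st \<sigma>"
  using statistic unfolding permutation_statistic_def by blast

lemma determinesD:
  "determines n F \<Longrightarrow> is_permutation \<pi> \<Longrightarrow> is_permutation \<sigma> \<Longrightarrow> length \<pi> = n \<Longrightarrow> length \<sigma> = n \<Longrightarrow>
    st \<pi> = st \<sigma> \<Longrightarrow> F \<pi> = F \<sigma>"
  unfolding determines_def by blast

lemma trivial_onD:
  "trivial_on n \<Longrightarrow> is_permutation \<pi> \<Longrightarrow> is_permutation \<sigma> \<Longrightarrow> length \<pi> = n \<Longrightarrow> length \<sigma> = n \<Longrightarrow>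
    st \<pi> = st \<sigma>"
  unfolding trivial_on_def by blast

text \<open>Substring compatibility with offsets counted from 0. The empty window, excluded by the
  bounds on \<open>i\<close> and \<open>j\<close> there, is the same for both words.\<close>

lemma st_window:
  assumes "is_permutation \<pi>" "is_permutation \<sigma>" "length \<pi> = length \<sigma>" "st \<pi> = st \<sigma>" "i + k \<le> length \<pi>"
  shows "st (take k (drop i \<pi>)) = st (take k (drop i \<sigma>))"
proof (cases "k = 0")
  case False
  have "st_sim st (substring \<pi> (Suc i) (i + k)) (substring \<sigma> (Suc i) (i + k))"
    using bicompatible[unfolded bicompatible_def substring_compatible_def, THEN conjunct2, rule_format,
      of \<pi> \<sigma> "Suc i" "i + k"] assms False by (simp add: st_sim_def)
  then show ?thesis using False by (simp add: substring_def st_sim_def)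
qed simp

lemma shuffles_st:
  assumes "disjoint_perms u w" "disjoint_perms u' w'" "st u = st u'" "st w = st w'"
    "length u = length u'" "length w = length w'"
  shows "image_mset st (mset_set (shuffles u w)) = image_mset st (mset_set (shuffles u' w'))"
  using bicompatible assms unfolding bicompatible_def shuffle_compatible_def by blast

text \<open>\<open>F\<close> factors through \<open>st\<close> on words of the length in question,
  so its multiset of values is the image of that of \<open>st\<close>.\<close>

lemma shuffles_st_image:
  assumes "disjoint_perms u w" "disjoint_perms u' w'" "st u = st u'" "st w = st w'"
    "length u = length u'" "length w = length w'" "determines (length u + length w) F"
  shows "image_mset F (mset_set (shuffles u w)) = image_mset F (mset_set (shuffles u' w'))"
proof -
  \<comment> \<open>\<open>G\<close> is the factor: any word of the right length with value
    \<open>s\<close> may serve as representative, since \<open>F\<close> cannot tell two of them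
    apart.\<close>
  define G where
    "G s = F (SOME \<tau>. is_permutation \<tau> \<and> length \<tau> = length u + length w \<and> st \<tau> = s)" for s
  have G: "F \<tau> = G (st \<tau>)" if "is_permutation \<tau>" "length \<tau> = length u + length w" for \<tau>
  proof -
    let ?P = "\<lambda>\<tau>'. is_permutation \<tau>' \<and> length \<tau>' = length u + length w \<and> st \<tau>' = st \<tau>"
    have "?P (SOME \<tau>'. ?P \<tau>')" by (rule someI[of ?P \<tau>]) (use that in blast)
    then show ?thesis unfolding G_def
      by (intro determinesD[OF assms(7)]) (use that in simp_all)
  qed
  have *: "image_mset F (mset_set (shuffles a b)) = image_mset G (image_mset st (mset_set (shuffles a b)))"
    if "disjoint_perms a b" "length a + length b = length u + length w" for a b
    unfolding image_mset.compositionality o_def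
    by (rule image_mset_cong, rule G) (use that shuffles_permutation in auto)
  have "image_mset F (mset_set (shuffles u w)) = image_mset G (image_mset st (mset_set (shuffles u w)))"
    by (rule *) (use assms(1) in blast)+
  also have "\<dots> = image_mset G (image_mset st (mset_set (shuffles u' w')))"
    using shuffles_st[OF assms(1-6)] by simp
  also have "\<dots> = image_mset F (mset_set (shuffles u' w'))"
    by (rule *[symmetric]) (use assms(2,5,6) in simp_all)
  finally show ?thesis .
qed

text \<open>The pair of \<open>st\<close> and \<open>Q\<close> is again determined by
  \<open>st\<close>; filtering by its second component restricts shuffle compatibility to the
  shuffles with property \<open>Q\<close>.\<close>

lemma shuffles_st_filter:
  assumes "disjoint_perms u w" "disjoint_perms u' w'" "st u = st u'" "st w = st w'"
    "length u = length u'" "length w = length w'" "determines (length u + length w) Q"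
  shows "image_mset st (mset_set {\<tau> \<in> shuffles u w. Q \<tau>}) =
    image_mset st (mset_set {\<tau> \<in> shuffles u' w'. Q \<tau>})"
proof -
  let ?F = "\<lambda>\<tau>. (st \<tau>, Q \<tau>)"
  have "determines (length u + length w) ?F"
    using assms(7) unfolding determines_def by blast
  then have "image_mset ?F (mset_set (shuffles u w)) = image_mset ?F (mset_set (shuffles u' w'))"
    by (rule shuffles_st_image[OF assms(1-6)])
  then have "image_mset fst (filter_mset snd (image_mset ?F (mset_set (shuffles u w)))) =
    image_mset fst (filter_mset snd (image_mset ?F (mset_set (shuffles u' w'))))"
    by (rule arg_cong)
  then show ?thesis
    by (simp add: filter_mset_image_mset image_mset.compositionality o_def)
qed

lemma st_single: "0 < x \<Longrightarrow> 0 < y \<Longrightarrow> st [x] = st [y]"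
  by (rule st_order) (auto simp: is_permutation_def same_relative_order_def)

text \<open>Both filtered multisets equal the one for the letter \<open>above v\<close> shuffled
  with \<open>v\<close>. That one has at most one element, because at most one position of the
  maximal letter yields \<open>Q\<close>; so the two values coincide.\<close>

lemma st_eq_if_unique:
  assumes Q: "determines (Suc (length v)) Q"
    and v: "is_permutation v" "length v1 = length v" "length v2 = length v" "st v1 = st v" "st v2 = st v"
    and dis: "disjoint_perms [x] v1" "disjoint_perms [y] v2"
    and \<tau>: "\<tau>1 \<in> shuffles [x] v1" "\<tau>2 \<in> shuffles [y] v2" "Q \<tau>1" "Q \<tau>2"
    and unique: "\<And>i j. i \<le> length v \<Longrightarrow> j \<le> length v \<Longrightarrow> Q (insert_at i (above v) v) \<Longrightarrow>
      Q (insert_at j (above v) v) \<Longrightarrow> i = j"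
  shows "st \<tau>1 = st \<tau>2"
proof -
  let ?M = "\<lambda>x v. image_mset st (mset_set {\<tau> \<in> shuffles [x] v. Q \<tau>})"
  have eq: "?M z v' = ?M (above v) v" if "disjoint_perms [z] v'" "length v' = length v" "st v' = st v" for z v'
    using that disjoint_perms_above[OF v(1)] Q
    by (intro shuffles_st_filter) (auto intro!: st_single simp: disjoint_perms_single is_permutation_Cons)
  have mem: "st \<tau> \<in># ?M z v'" if "\<tau> \<in> shuffles [z] v'" "Q \<tau>" for \<tau> z v'
    using that by auto
  have "{\<tau> \<in> shuffles [above v] v. Q \<tau>} \<subseteq> {\<tau>}" if "\<tau> \<in> shuffles [above v] v" "Q \<tau>" for \<tau>
    using that unique by (auto simp: shuffles_single)
  then have one: "s = s'" if "s \<in># ?M (above v) v" "s' \<in># ?M (above v) v" for s s'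
    using that by auto
  show ?thesis
    by (rule one) (use mem \<tau> eq[OF dis(1) v(2,4)] eq[OF dis(2) v(3,5)] in metis)+
qed

end


section \<open>Descents\<close>

lemma Des_eq_iff:
  "length \<pi> = length \<sigma> \<Longrightarrow> Des \<pi> = Des \<sigma> \<longleftrightarrow>
    (\<forall>i. Suc i < length \<pi> \<longrightarrow> \<pi> ! Suc i < \<pi> ! i \<longleftrightarrow> \<sigma> ! Suc i < \<sigma> ! i)"
proof -
  assume len: "length \<pi> = length \<sigma>"
  have Des: "i \<in> Des w \<longleftrightarrow> (\<exists>k. i = Suc k \<and> Suc k < length w \<and> w ! Suc k < w ! k)" for i w
    by (cases i) (auto simp: Des_def)
  show ?thesis
    unfolding set_eq_iff Des using len by auto
qed

text \<open>Suppose positions \<open>k < k'\<close> give the same descents. The descent just after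
  the maximum at \<open>k\<close> must occur in the other word too; if it lies between letters of
  \<open>v\<close>, it reappears in the first word one place later. Repeating this produces a
  descent onto the maximum at \<open>k'\<close>, which is absurd.\<close>

lemma Des_insert_max_unique:
  assumes max: "\<forall>x\<in>set v. x < N" and "i \<le> length v" "j \<le> length v"
    and eq: "Des (insert_at i N v) = Des (insert_at j N v)"
  shows "i = j"
proof -
  have False if "k < k'" and "k' \<le> length v" and des: "Des (insert_at k N v) = Des (insert_at k' N v)" for k k'
  proof -
    define \<tau> \<tau>' where "\<tau> = insert_at k N v" and "\<tau>' = insert_at k' N v"
    have eq: "\<tau> ! Suc i < \<tau> ! i \<longleftrightarrow> \<tau>' ! Suc i < \<tau>' ! i" if "i < length v" for i
      using that des unfolding \<tau>_def \<tau>'_def by (subst (asm) Des_eq_iff) simp_all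
    have \<tau>: "\<tau> ! i = (if i < k then v ! i else if i = k then N else v ! (i - 1))" for i
      unfolding \<tau>_def using that by (intro nth_insert_at) simp
    have \<tau>': "\<tau>' ! i = (if i < k' then v ! i else if i = k' then N else v ! (i - 1))" for i
      unfolding \<tau>'_def using that by (intro nth_insert_at) simp
    have "\<tau>' ! Suc (k + m) < \<tau>' ! (k + m)" if "k + m < k'" for m
      using that
    proof (induction m)
      case 0
      have "v ! k < N" using 0 max \<open>k' \<le> length v\<close> by simp
      then have "\<tau> ! Suc k < \<tau> ! k" by (simp add: \<tau>)
      then show ?case using eq[of k] 0 \<open>k' \<le> length v\<close> by simp
    next
      case (Suc m)
      then have "v ! Suc (k + m) < v ! (k + m)" by (simp add: \<tau>')
      then have "\<tau> ! Suc (Suc (k + m)) < \<tau> ! Suc (k + m)" by (simp add: \<tau>)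
      then show ?case using eq[of "Suc (k + m)"] Suc.prems \<open>k' \<le> length v\<close> by simp
    qed
    from this[of "k' - 1 - k"] have "\<tau>' ! k' < \<tau>' ! (k' - 1)"
      using \<open>k < k'\<close> by simp
    then have "N < v ! (k' - 1)" using \<open>k < k'\<close> by (simp add: \<tau>')
    moreover have "v ! (k' - 1) < N" using max \<open>k < k'\<close> \<open>k' \<le> length v\<close> by simp
    ultimately show False by simp
  qed
  then show ?thesis using assms(2-4) by (metis linorder_neqE_nat)
qed

context bicompatible_statistic
begin

lemma st_pair:
  assumes "is_permutation [x, y]"
  shows "st [x, y] = st (if x < y then [1, 2] else [2, 1])"
  by (rule st_order) (use assms in \<open>auto simp: is_permutation_def same_relative_order_def less_Suc_eq\<close>)

lemma take_2_drop: "Suc i < length w \<Longrightarrow> take 2 (drop i w) = [w ! i, w ! Suc i]"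
  by (rule nth_equalityI) (auto simp: less_2_cases_iff)

text \<open>Windows of length 2 reveal whether a position is a descent.\<close>

lemma determines_Des:
  assumes "st [1, 2] \<noteq> st [2, 1]"
  shows "determines n Des"
  unfolding determines_def
proof (intro allI impI)
  fix \<pi> \<sigma> :: "nat list"
  assume *: "is_permutation \<pi>" "is_permutation \<sigma>" "length \<pi> = n" "length \<sigma> = n" "st \<pi> = st \<sigma>"
  have "\<pi> ! Suc i < \<pi> ! i \<longleftrightarrow> \<sigma> ! Suc i < \<sigma> ! i" if "Suc i < n" for i
  proof -
    have "st (take 2 (drop i \<pi>)) = st (take 2 (drop i \<sigma>))"
      by (intro st_window) (use that * in simp_all)
    then have eq: "st [\<pi> ! i, \<pi> ! Suc i] = st [\<sigma> ! i, \<sigma> ! Suc i]"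
      using that * by (simp add: take_2_drop)
    have w: "is_permutation [w ! i, w ! Suc i]" if "is_permutation w" "length w = n" for w
      using that \<open>Suc i < n\<close> by (auto simp: is_permutation_def nth_eq_iff_index_eq)
    have "st (if \<pi> ! i < \<pi> ! Suc i then [1, 2] else [2, 1]) = st (if \<sigma> ! i < \<sigma> ! Suc i then [1, 2] else [2, 1])"
      using eq st_pair[OF w[of \<pi>]] st_pair[OF w[of \<sigma>]] * by metis
    then have "\<pi> ! i < \<pi> ! Suc i \<longleftrightarrow> \<sigma> ! i < \<sigma> ! Suc i"
      using assms by (simp split: if_split_asm)
    then show ?thesis using w[of \<pi>] w[of \<sigma>] * by (auto simp: is_permutation_def)
  qed
  then show "Des \<pi> = Des \<sigma>" using * by (subst Des_eq_iff) auto
qed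

text \<open>Induction on the length: deleting the first letters leaves words with equal descent
  sets, hence equal values, and a maximal letter fits into the tail in at most one way that yields
  the given descent set.\<close>

lemma st_eq_if_Des_eq:
  assumes "st [1, 2] \<noteq> st [2, 1]"
  shows "is_permutation \<pi> \<Longrightarrow> is_permutation \<sigma> \<Longrightarrow> length \<pi> = length \<sigma> \<Longrightarrow> Des \<pi> = Des \<sigma> \<Longrightarrow> st \<pi> = st \<sigma>"
proof (induction \<pi> arbitrary: \<sigma>)
  case (Cons x v)
  from Cons.prems(3) obtain y w where \<sigma>: "\<sigma> = y # w" by (cases \<sigma>) auto
  have len: "length w = length v" using Cons.prems(3) \<sigma> by simp
  have perm: "is_permutation v" "is_permutation w" "disjoint_perms [x] v" "disjoint_perms [y] w"
    using Cons.prems \<sigma> by (auto simp: is_permutation_Cons disjoint_perms_single)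
  have "v ! Suc i < v ! i \<longleftrightarrow> w ! Suc i < w ! i" if "Suc i < length v" for i
    using Cons.prems(4)[unfolded \<sigma>, THEN iffD1[OF Des_eq_iff, rotated], rule_format, of "Suc i"] len that
    by simp
  then have "Des v = Des w" using len by (simp add: Des_eq_iff)
  then have "st v = st w" by (intro Cons.IH perm) (simp add: len)
  let ?Q = "\<lambda>\<tau>. Des \<tau> = Des (x # v)"
  have "determines (Suc (length v)) ?Q"
    using determines_Des[OF assms] unfolding determines_def by metis
  then show ?case unfolding \<sigma>
  proof (rule st_eq_if_unique)
    show "x # v \<in> shuffles [x] v" "y # w \<in> shuffles [y] w" by (rule shuffles_Cons)+
    show "i = j" if "i \<le> length v" "j \<le> length v" "?Q (insert_at i (above v) v)" "?Q (insert_at j (above v) v)" for i j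
      using that above_greater by (intro Des_insert_max_unique[of v "above v"]) auto
  qed (use perm len \<open>st v = st w\<close> Cons.prems(4) \<sigma> in simp_all)
qed simp

lemma st_equiv_Des:
  assumes "st [1, 2] \<noteq> st [2, 1]"
  shows "st_equiv st Des"
  unfolding st_equiv_def st_sim_def
proof (intro allI impI)
  fix \<pi> \<sigma>
  assume "is_permutation \<pi>" "is_permutation \<sigma>"
  then show "(length \<pi> = length \<sigma> \<and> st \<pi> = st \<sigma>) \<longleftrightarrow> (length \<pi> = length \<sigma> \<and> Des \<pi> = Des \<sigma>)"
    using st_eq_if_Des_eq[OF assms] determinesD[OF determines_Des[OF assms]] by blast
qed

end


section \<open>Peaks\<close>

text \<open>An enumeration of \<open>shuffles\<close> as a list, so that concrete shuffles can be
  computed; for disjoint words it has no repetitions.\<close>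

fun shuf :: "'a list \<Rightarrow> 'a list \<Rightarrow> 'a list list" where
  "shuf [] w = [w]"
| "shuf u [] = [u]"
| "shuf (x # u) (y # w) = map ((#) x) (shuf u (y # w)) @ map ((#) y) (shuf (x # u) w)"

lemma set_shuf: "set (shuf u w) = shuffles u w"
  by (induction u w rule: shuf.induct) auto

lemma distinct_shuf: "set u \<inter> set w = {} \<Longrightarrow> distinct (shuf u w)"
  by (induction u w rule: shuf.induct) (auto simp: distinct_map)

lemma mset_shuf: "disjoint_perms u w \<Longrightarrow> mset_set (shuffles u w) = mset (shuf u w)"
  by (metis disjoint_perms_def distinct_shuf mset_set_set set_shuf)

text \<open>\<open>Pk\<close> with positions counted from 0, to match list indices.\<close>

definition peaks :: "nat list \<Rightarrow> nat set" where
  "peaks w = {i. 0 < i \<and> Suc i < length w \<and> w ! (i - 1) < w ! i \<and> w ! Suc i < w ! i}"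

lemma Pk_eq_image_peaks: "Pk w = Suc ` peaks w"
proof -
  have "i \<in> Pk w \<longleftrightarrow> (\<exists>k. i = Suc k \<and> k \<in> peaks w)" for i
    by (cases i) (auto simp: Pk_def peaks_def)
  then show ?thesis by auto
qed

lemma Pk_eq_iff: "Pk \<pi> = Pk \<sigma> \<longleftrightarrow> peaks \<pi> = peaks \<sigma>"
  by (simp add: Pk_eq_image_peaks inj_image_eq_iff)

section \<open>Peak sets under deletion of the first letter and insertion of a maximal
  letter\<close>

lemma peaks_Cons: "i \<in> peaks w \<longleftrightarrow> 0 < i \<and> Suc i \<in> peaks (x # w)"
  by (cases i) (auto simp: peaks_def)

lemma peaks_not_adjacent: "i \<in> peaks w \<Longrightarrow> Suc i \<notin> peaks w"
  by (auto simp: peaks_def)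

text \<open>The maximum becomes a peak unless it stands at an end. Peaks of \<open>v\<close> at
  \<open>k - 1\<close> and \<open>k\<close> become its neighbours and are lost; those further left
  stay, those further right move by one.\<close>

lemma peaks_insert_max:
  assumes max: "\<forall>x\<in>set v. x < N" and k: "k \<le> length v"
  shows "i \<in> peaks (insert_at k N v) \<longleftrightarrow>
    (i = k \<and> 0 < k \<and> k < length v) \<or> (Suc i < k \<and> i \<in> peaks v) \<or> (Suc k < i \<and> i - 1 \<in> peaks v)"
proof -
  have less: "v ! j < N" "\<not> N < v ! j" if "j < length v" for j
    using that max by (auto simp: not_less less_imp_le)
  consider "Suc i < k" | "Suc i = k" | "i = k" | "i = Suc k" | "Suc k < i" by linarith
  then show ?thesis
  proof cases
    case 1
    then show ?thesis using k by (auto simp: peaks_def nth_insert_at)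
  next
    case 2
    then show ?thesis using k less[of i] by (auto simp: peaks_def nth_insert_at)
  next
    case 3
    then show ?thesis using k less[of "i - 1"] less[of i] by (auto simp: peaks_def nth_insert_at)
  next
    case 4
    then show ?thesis using k less[of k] by (auto simp: peaks_def nth_insert_at)
  next
    case 5
    then obtain m where "i = Suc (Suc m)" "k < Suc m" by (cases i; cases "i - 1") auto
    then show ?thesis using k 5 by (auto simp: peaks_def nth_insert_at)
  qed
qed

text \<open>The peak \<open>p\<close> can only be the inserted maximum: had it stayed in place from
  \<open>v\<close>, \<open>Suc p\<close> would also be in \<open>P\<close>; had it moved, it would
  come from \<open>p - 1\<close>, below the bound on the peaks of \<open>v\<close>.\<close>

lemma peaks_insert_max_least_unique:
  assumes max: "\<forall>x\<in>set v. x < N" and k: "k \<le> length v"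
    and v: "peaks v = {q. Suc q \<in> P \<and> p \<le> q}" and P: "peaks (insert_at k N v) = P"
    and p: "p \<in> P"
  shows "k = p"
proof -
  have "Suc p \<notin> P" using p P peaks_not_adjacent by blast
  have "p \<in> peaks (insert_at k N v)" using p P by simp
  then show ?thesis
    using \<open>Suc p \<notin> P\<close> unfolding peaks_insert_max[OF max k] by (auto simp: v)
qed

text \<open>For a position other than 0 and \<open>p\<close>, the peak \<open>p\<close> must come
  from \<open>p - 1\<close>, to the right of the maximum; then the maximum itself is a peak smaller
  than the least one.\<close>

lemma peaks_insert_max_shift:
  assumes max: "\<forall>x\<in>set v. x < N" and k: "k \<le> length v"
    and v: "peaks v = {q. Suc q \<in> P}" and P: "peaks (insert_at k N v) = P"
    and p: "p \<in> P" "\<forall>q\<in>P. p \<le> q"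
  shows "k = 0 \<or> k = p"
proof (rule ccontr)
  assume k0: "\<not> ?thesis"
  have "Suc p \<notin> P" using p P peaks_not_adjacent by blast
  have "p \<in> peaks (insert_at k N v)" using p P by simp
  then have "Suc k < p"
    using \<open>Suc p \<notin> P\<close> k0 unfolding peaks_insert_max[OF max k] by (auto simp: v)
  moreover have "p - 1 \<in> peaks v"
    using \<open>p \<in> peaks _\<close> \<open>Suc k < p\<close> unfolding peaks_insert_max[OF max k] by auto
  then have "p - 1 < length v" by (simp add: peaks_def)
  ultimately have "k \<in> P"
    using k0 unfolding P[symmetric] peaks_insert_max[OF max k] by auto
  then show False using p \<open>Suc k < p\<close> by auto
qed

lemma peaks_insert_max_empty:
  assumes max: "\<forall>x\<in>set v. x < N" and k: "k \<le> length v" and P: "peaks (insert_at k N v) = {}"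
  shows "k = 0 \<or> k = length v"
  using P k unfolding set_eq_iff peaks_insert_max[OF max k] by auto

context bicompatible_statistic
begin

lemma shuf_st_image:
  assumes "disjoint_perms u w" "disjoint_perms u' w'" "st u = st u'" "st w = st w'"
    "length u = length u'" "length w = length w'" "determines (length u + length w) F"
  shows "mset (map F (shuf u w)) = mset (map F (shuf u' w'))"
  using shuffles_st_image[OF assms] by (simp add: mset_shuf[OF assms(1)] mset_shuf[OF assms(2)])

lemma determines_st: "determines n st"
  by (simp add: determines_def)

section \<open>Values on words of length two and three\<close>

lemma trivial_on_2:
  assumes "st [1, 2] = st [2, 1]"
  shows "trivial_on 2"
  unfolding trivial_on_def
proof (intro allI impI)
  fix \<pi> \<sigma> :: "nat list"
  assume *: "is_permutation \<pi>" "is_permutation \<sigma>" "length \<pi> = 2" "length \<sigma> = 2"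
  have "st w = st [1, 2]" if "is_permutation w" "length w = 2" for w
  proof -
    from that(2) obtain x y where w: "w = [x, y]" by (auto simp: length_Suc_conv numeral_2_eq_2)
    show ?thesis using st_pair[of x y] that(1) assms unfolding w by (simp split: if_splits)
  qed
  from this[OF *(1,3)] this[OF *(2,4)] show "st \<pi> = st \<sigma>" by simp
qed

text \<open>All words of length 2 are equivalent, so the shuffles of a letter with a pair always
  give the same multiset of three values. Comparing two shuffle sets with two words in common and
  cancelling these leaves each equation.\<close>

lemma st_length_3_eqs:
  assumes "st [1, 2] = st [2, 1]"
  shows "st [2, 3, 1] = st [1, 3, 2]" "st [3, 1, 2] = st [2, 1, 3]" "st [3, 2, 1] = st [1, 2, 3]"
proof -
  have shuf: "mset (map st (shuf [x] [y, z])) = mset (map st (shuf [1] [2, 3]))"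
    if "is_permutation [x, y, z]" for x y z
  proof (rule shuf_st_image)
    show "st [y, z] = st [2, 3]"
      by (rule trivial_onD[OF trivial_on_2[OF assms]]) (use that in \<open>simp_all add: is_permutation_def\<close>)
    show "st [x] = st [1]" by (rule st_single) (use that in \<open>simp_all add: is_permutation_def\<close>)
  qed (use that in \<open>simp_all add: disjoint_perms_append determines_st is_permutation_def\<close>)
  have *: "mset (map st (shuf [2] [1, 3])) = mset (map st (shuf [1] [2, 3]))"
    "mset (map st (shuf [3] [1, 2])) = mset (map st (shuf [2] [1, 3]))"
    "mset (map st (shuf [3] [2, 1])) = mset (map st (shuf [1] [2, 3]))"
    using shuf[of 2 1 3] shuf[of 3 1 2] shuf[of 3 2 1] by (simp_all only: is_permutation_def) simp_all
  show "st [2, 3, 1] = st [1, 3, 2]" using *(1) by simp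
  show "st [3, 1, 2] = st [2, 1, 3]" using *(2) by simp
  show "st [3, 2, 1] = st [1, 2, 3]" using *(3) by simp
qed

text \<open>The three equations merge the six orders into peak, valley and monotone.\<close>

lemma st_triple:
  assumes "st [1, 2] = st [2, 1]" "is_permutation [x, y, z]"
  shows "st [x, y, z] = (if x < y \<and> z < y then st [1, 3, 2] else if y < x \<and> y < z then st [2, 1, 3] else st [1, 2, 3])"
proof -
  have order: "st [x, y, z] = st [i, j, k]"
    if "is_permutation [i, j, k]" "x < y \<longleftrightarrow> i < j" "y < z \<longleftrightarrow> j < k" "x < z \<longleftrightarrow> i < k" for i j k
    using assms(2) that
    by (intro st_order) (auto simp: is_permutation_def same_relative_order_def less_Suc_eq nth_Cons')
  have ne: "x \<noteq> y" "y \<noteq> z" "x \<noteq> z" using assms(2) by (auto simp: is_permutation_def)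
  consider "x < y" "y < z" | "x < y" "z < y" "x < z" | "x < y" "z < y" "z < x"
    | "y < x" "y < z" "x < z" | "y < x" "y < z" "z < x" | "y < x" "z < y"
    using ne by linarith
  then show ?thesis
  proof cases
    case 1 then show ?thesis using order[of 1 2 3] by (simp add: is_permutation_def)
  next
    case 2 then show ?thesis using order[of 1 3 2] by (simp add: is_permutation_def)
  next
    case 3 then show ?thesis using order[of 2 3 1] st_length_3_eqs[OF assms(1)] by (simp add: is_permutation_def)
  next
    case 4 then show ?thesis using order[of 2 1 3] by (simp add: is_permutation_def)
  next
    case 5 then show ?thesis using order[of 3 1 2] st_length_3_eqs[OF assms(1)] by (simp add: is_permutation_def)
  next
    case 6 then show ?thesis using order[of 3 2 1] st_length_3_eqs[OF assms(1)] by (simp add: is_permutation_def)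
  qed
qed

lemma take_3_drop: "Suc (Suc i) < length w \<Longrightarrow> take 3 (drop i w) = [w ! i, w ! Suc i, w ! Suc (Suc i)]"
  by (rule nth_equalityI) (auto simp: less_Suc_eq numeral_3_eq_3)

text \<open>By the inequalities, a window of length 3 has the value of 132 exactly when its middle
  letter is a peak.\<close>

lemma determines_peaks:
  assumes "st [1, 2] = st [2, 1]" "st [1, 3, 2] \<noteq> st [1, 2, 3]" "st [1, 3, 2] \<noteq> st [2, 1, 3]"
  shows "determines n peaks"
  unfolding determines_def
proof (intro allI impI)
  fix \<pi> \<sigma> :: "nat list"
  assume *: "is_permutation \<pi>" "is_permutation \<sigma>" "length \<pi> = n" "length \<sigma> = n" "st \<pi> = st \<sigma>"
  have "Suc i \<in> peaks \<pi> \<longleftrightarrow> Suc i \<in> peaks \<sigma>" if "Suc (Suc i) < n" for i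
  proof -
    have "st (take 3 (drop i \<pi>)) = st (take 3 (drop i \<sigma>))"
      by (intro st_window) (use that * in simp_all)
    then have eq: "st [\<pi> ! i, \<pi> ! Suc i, \<pi> ! Suc (Suc i)] = st [\<sigma> ! i, \<sigma> ! Suc i, \<sigma> ! Suc (Suc i)]"
      using that * by (simp add: take_3_drop)
    have w: "is_permutation [w ! i, w ! Suc i, w ! Suc (Suc i)]" if "is_permutation w" "length w = n" for w
      using that \<open>Suc (Suc i) < n\<close> by (auto simp: is_permutation_def nth_eq_iff_index_eq)
    have pk: "Suc i \<in> peaks w \<longleftrightarrow> st [w ! i, w ! Suc i, w ! Suc (Suc i)] = st [1, 3, 2]"
      if "is_permutation w" "length w = n" for w
      using st_triple[OF assms(1) w[OF that]] assms(2,3) that(2) \<open>Suc (Suc i) < n\<close>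
      by (auto simp: peaks_def split: if_splits)
    show ?thesis using pk[of \<pi>] pk[of \<sigma>] * eq by simp
  qed
  moreover have "\<exists>j. i = Suc j \<and> Suc (Suc j) < n" if "i \<in> peaks w" "length w = n" for i w
    using that by (cases i) (auto simp: peaks_def)
  ultimately show "peaks \<pi> = peaks \<sigma>" using * by blast
qed

end


section \<open>Manipulating and realising peak sets\<close>

lemma peaks_eq_Cons: "peaks w = {q. Suc q \<in> peaks (x # w) \<and> 1 \<le> q}"
  using peaks_Cons[of _ w x] by (intro set_eqI) (simp, linarith)

lemma peaks_sorted: "sorted_wrt (<) w \<Longrightarrow> peaks w = {}"
  by (fastforce simp: peaks_def sorted_wrt_iff_nth_less)

lemma peaks_descent: "y < x \<Longrightarrow> peaks (x # y # r) = Suc ` peaks (y # r)"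
proof -
  assume "y < x"
  then have "i \<in> peaks (x # y # r) \<longleftrightarrow> (\<exists>k. i = Suc k \<and> k \<in> peaks (y # r))" for i
    by (cases i; cases "i - 1") (auto simp: peaks_def)
  then show ?thesis by auto
qed

text \<open>The two smallest letters in front form no peak, and the letter after them has a smaller
  left neighbour in either order.\<close>

lemma peaks_swap:
  assumes "x < y" "\<forall>z\<in>set r. y < z"
  shows "peaks (y # x # r) = peaks (x # y # r)"
proof -
  have "i \<in> peaks (y # x # r) \<longleftrightarrow> i \<in> peaks (x # y # r)" for i
    using assms by (cases r; cases i; cases "i - 1"; cases "i - 2") (auto simp: peaks_def)
  then show ?thesis by blast
qed

text \<open>Every admissible peak set is realised by raising the letters at the peaks above all others.\<close>

definition peak_word :: "nat \<Rightarrow> nat set \<Rightarrow> nat list" where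
  "peak_word m S = map (\<lambda>i. Suc i + (if i \<in> S then m else 0)) [0..<m]"

lemma peaks_peak_word:
  assumes "\<And>i. i \<in> S \<Longrightarrow> 0 < i \<and> Suc i < m" "\<And>i. i \<in> S \<Longrightarrow> Suc i \<notin> S"
  shows "peaks (peak_word m S) = S"
proof -
  have prev: "i - 1 \<notin> S" if "i \<in> S" for i
    using assms[of "i - 1"] assms(1)[OF that] that by auto
  have len: "length (peak_word m S) = m" by (simp add: peak_word_def)
  have nth: "peak_word m S ! i = Suc i + (if i \<in> S then m else 0)" if "i < m" for i
    using that by (simp add: peak_word_def)
  have "i \<in> peaks (peak_word m S) \<longleftrightarrow> i \<in> S" if "0 < i" "Suc i < m" for i
    using that prev[of i] assms(2)[of i] by (auto simp: peaks_def nth len)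
  moreover have "0 < i \<and> Suc i < m" if "i \<in> peaks (peak_word m S)" for i
    using that by (simp add: peaks_def len)
  ultimately show ?thesis using assms(1) by blast
qed

text \<open>The raised letters start at index 2 or later; this is the situation in which
  \<open>peaks_swap\<close> applies.\<close>

lemma peak_word_Cons:
  assumes "0 \<notin> S" "1 \<notin> S" "2 \<le> m"
  shows "\<exists>r. peak_word m S = 1 # 2 # r \<and> (\<forall>z\<in>set r. 2 < z)"
proof -
  have "[0..<m] = 0 # 1 # [2..<m]"
    using assms(3) by (simp add: upt_conv_Cons numeral_2_eq_2)
  then show ?thesis using assms by (auto simp: peak_word_def)
qed

lemma is_permutation_peak_word: "is_permutation (peak_word m S)"
  by (auto simp: is_permutation_def peak_word_def distinct_map inj_on_def split: if_splits)

lemma same_relative_order_map: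
  assumes "\<And>x y. x \<in> set w \<Longrightarrow> y \<in> set w \<Longrightarrow> f x < f y \<longleftrightarrow> x < (y::nat)"
  shows "same_relative_order (map f w) w"
  using assms by (simp add: same_relative_order_def)

context bicompatible_statistic
begin

section \<open>Equal peaks give equal values of the statistic\<close>

definition peaks_determine :: "nat \<Rightarrow> bool" where
  "peaks_determine n \<longleftrightarrow> (\<forall>\<pi> \<sigma>. is_permutation \<pi> \<longrightarrow> is_permutation \<sigma> \<longrightarrow> length \<pi> = n \<longrightarrow> length \<sigma> = n \<longrightarrow>
    peaks \<pi> = peaks \<sigma> \<longrightarrow> st \<pi> = st \<sigma>)"

lemma peaks_determineD:
  "peaks_determine n \<Longrightarrow> is_permutation \<pi> \<Longrightarrow> is_permutation \<sigma> \<Longrightarrow> length \<pi> = n \<Longrightarrow> length \<sigma> = n \<Longrightarrow>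
    peaks \<pi> = peaks \<sigma> \<Longrightarrow> st \<pi> = st \<sigma>"
  unfolding peaks_determine_def by blast

text \<open>The two-element counterpart of \<open>st_eq_if_unique\<close>: a maximal letter has at
  most two positions with \<open>Q\<close>, so by equality of sizes the distinct shuffles
  \<open>\<tau>1\<close> and \<open>\<tau>2\<close> are all those with \<open>Q\<close>, and their
  values describe every equivalent shuffle.\<close>

lemma st_filter_two:
  assumes Q: "determines (Suc (length v)) Q"
    and v: "is_permutation v" "length w = length v" "st w = st v"
    and dis: "disjoint_perms [x] v" "disjoint_perms [z] w"
    and \<tau>: "\<tau>1 \<in> shuffles [x] v" "\<tau>2 \<in> shuffles [x] v" "Q \<tau>1" "Q \<tau>2" "\<tau>1 \<noteq> \<tau>2"
    and two: "\<And>k. k \<le> length v \<Longrightarrow> Q (insert_at k (above v) v) \<Longrightarrow> k = a \<or> k = b"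
  shows "image_mset st (mset_set {\<tau> \<in> shuffles [z] w. Q \<tau>}) = {#st \<tau>1, st \<tau>2#}"
proof -
  let ?S = "\<lambda>x v. {\<tau> \<in> shuffles [x] v. Q \<tau>}"
  let ?M = "\<lambda>x v. image_mset st (mset_set (?S x v))"
  have eq: "?M y v' = ?M x v" if "disjoint_perms [y] v'" "length v' = length v" "st v' = st v" for y v'
    using that dis(1) Q
    by (intro shuffles_st_filter) (auto intro!: st_single simp: disjoint_perms_single is_permutation_Cons)
  have "size (?M (above v) v) = size (?M x v)"
    using eq[OF disjoint_perms_above[OF v(1)]] by simp
  then have "card (?S x v) = card (?S (above v) v)" by simp
  also have "?S (above v) v \<subseteq> {insert_at a (above v) v, insert_at b (above v) v}"
    using two by (auto simp: shuffles_single)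
  then have "card (?S (above v) v) \<le> card {insert_at a (above v) v, insert_at b (above v) v}"
    by (intro card_mono) simp_all
  also have "\<dots> \<le> 2" by (simp add: card_insert_if)
  finally have "card (?S x v) \<le> card {\<tau>1, \<tau>2}" using \<tau>(5) by simp
  moreover have "{\<tau>1, \<tau>2} \<subseteq> ?S x v" using \<tau> by auto
  ultimately have "{\<tau>1, \<tau>2} = ?S x v"
    by (intro card_seteq) simp_all
  then have "?M x v = image_mset st (mset_set {\<tau>1, \<tau>2})" by simp
  also have "\<dots> = {#st \<tau>1, st \<tau>2#}" using \<tau>(5) by simp
  finally show ?thesis using eq[OF dis(2) v(2,3)] by simp
qed

context
  assumes pair: "st [1, 2] = st [2, 1]"
    and peak: "st [1, 3, 2] \<noteq> st [1, 2, 3]" "st [1, 3, 2] \<noteq> st [2, 1, 3]"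
begin

lemma determines_peaks_eq: "determines n (\<lambda>\<tau>. peaks \<tau> = P)"
  using determines_peaks[OF pair peak, of n] unfolding determines_def by metis

text \<open>\<open>v1\<close> and \<open>v2\<close> have equal peaks, hence equal values by
  \<open>IH\<close>, and \<open>peaks_insert_max_least_unique\<close> leaves only one possible
  position for a maximal letter.\<close>

lemma st_eq_if_least_peak_deleted:
  assumes IH: "peaks_determine m"
    and dis: "disjoint_perms [x] v1" "disjoint_perms [y] v2"
    and len: "length v1 = m" "length v2 = m"
    and \<tau>: "\<tau>1 \<in> shuffles [x] v1" "\<tau>2 \<in> shuffles [y] v2" "peaks \<tau>1 = P" "peaks \<tau>2 = P"
    and v: "peaks v1 = {q. Suc q \<in> P \<and> p \<le> q}" "peaks v2 = {q. Suc q \<in> P \<and> p \<le> q}"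
    and p: "p \<in> P"
  shows "st \<tau>1 = st \<tau>2"
proof (rule st_eq_if_unique[where v = v1 and Q = "\<lambda>\<tau>. peaks \<tau> = P" and x = x and y = y
      and ?v1.0 = v1 and ?v2.0 = v2])
  have perm: "is_permutation v1" "is_permutation v2"
    using dis by (simp_all add: disjoint_perms_def)
  show "determines (Suc (length v1)) (\<lambda>\<tau>. peaks \<tau> = P)" by (rule determines_peaks_eq)
  show "st v2 = st v1"
    by (rule peaks_determineD[OF IH]) (use perm len v in simp_all)
  show "is_permutation v1" by (rule perm)
  show "i = j" if "i \<le> length v1" "j \<le> length v1" "peaks (insert_at i (above v1) v1) = P"
    "peaks (insert_at j (above v1) v1) = P" for i j
  proof -
    have max: "\<forall>x\<in>set v1. x < above v1" using above_greater by blast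
    show ?thesis
      using peaks_insert_max_least_unique[OF max that(1) v(1) that(3) p]
        peaks_insert_max_least_unique[OF max that(2) v(1) that(4) p] by simp
  qed
qed (use dis \<tau> len in simp_all)

text \<open>When the least peak is at index 2 or later, deleting the first letter leaves two
  positions for a maximal letter. So all words with peak set \<open>P\<close> take one of two
  values, those of \<open>1 # 2 # r'\<close> and \<open>2 # 1 # r'\<close>. These agree, because
  deleting their maximal letter at the least peak instead leaves a single position.\<close>

lemma st_eq_if_peaks_eq_late:
  assumes IH: "peaks_determine m"
    and \<pi>: "is_permutation (z # w)" "length w = m" "peaks (z # w) = P"
    and p: "p \<in> P" "\<forall>q\<in>P. p \<le> q" "2 \<le> p"
  shows "\<exists>s. \<forall>z w. is_permutation (z # w) \<longrightarrow> length w = m \<longrightarrow> peaks (z # w) = P \<longrightarrow> st (z # w) = s"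
proof -
  have P: "0 < q \<and> Suc q < Suc m \<and> Suc q \<notin> P" if "q \<in> P" for q
    using \<pi>(2) peaks_not_adjacent that unfolding \<pi>(3)[symmetric] by (auto simp: peaks_def)
  \<comment> \<open>\<open>S\<close> is \<open>P\<close> without its least element, moved down by
    one.\<close>
  define S where "S = {q. Suc q \<in> P \<and> p \<le> q}"
  have peaks_S: "peaks (peak_word m S) = S"
    by (rule peaks_peak_word) (use P p in \<open>auto simp: S_def\<close>)
  have m: "2 \<le> m" "p < m" using P[OF p(1)] p(3) by auto
  obtain r where r: "peak_word m S = 1 # 2 # r" "\<forall>z\<in>set r. 2 < z"
    using peak_word_Cons[of S m] p(3) m by (auto simp: S_def)
  \<comment> \<open>\<open>v\<close> and \<open>v'\<close> differ in the order of their two smallest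
    letters and so have the same peaks; inserting \<open>N\<close> at \<open>p\<close>, behind these
    letters, turns both into words with peak set \<open>P\<close>.\<close>
  define v where "v = 1 # 2 # r"
  define v' where "v' = 2 # 1 # r"
  define N where "N = above v"
  define r' where "r' = insert_at (p - 2) N r"
  have len: "length v = m" "length v' = m"
    using arg_cong[OF r(1), of length] by (simp_all add: v_def v'_def peak_word_def)
  have max: "\<forall>x\<in>set v. x < N" "\<forall>x\<in>set v'. x < N"
    using above_greater[of _ v] by (auto simp: N_def v_def v'_def)
  have perm_v: "is_permutation v" "is_permutation v'"
    using is_permutation_peak_word[of m S] r by (auto simp: v_def v'_def is_permutation_def)
  have dis: "disjoint_perms [N] v" "disjoint_perms [N] v'"
    using perm_v max by (auto simp: disjoint_perms_single is_permutation_Cons N_def above_def)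
  have peaks_v: "peaks v = S" "peaks v' = S"
    using peaks_S r peaks_swap[of 1 2 r] by (simp_all add: v_def v'_def)
  have ins: "insert_at p N v = 1 # 2 # r'" "insert_at p N v' = 2 # 1 # r'"
    using p(3) by (cases p; cases "p - 1"; simp add: insert_at_def v_def v'_def r'_def)+
  have peaks_ins: "peaks (insert_at p N u) = P" if "peaks u = S" "\<forall>x\<in>set u. x < N" "length u = m" for u
  proof -
    have "i \<in> peaks (insert_at p N u) \<longleftrightarrow> i \<in> P" for i
    proof -
      have "Suc p \<notin> P" using P p(1) by blast
      consider "i < p" | "i = p" | "i = Suc p" | "Suc p < i" by linarith
      then show ?thesis
      proof cases
        case 1
        then have "i \<notin> P" using p(2) by auto
        then show ?thesis using 1 m peaks_insert_max[OF that(2), of p i]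
          by (auto simp: that S_def)
      next
        case 2
        then show ?thesis using p m peaks_insert_max[OF that(2), of p i] by (auto simp: that)
      next
        case 3
        then show ?thesis using \<open>Suc p \<notin> P\<close> m peaks_insert_max[OF that(2), of p i] by (auto simp: that)
      next
        case 4
        then show ?thesis using m peaks_insert_max[OF that(2), of p i] by (auto simp: that S_def)
      qed
    qed
    then show ?thesis by blast
  qed
  have in_sh: "insert_at p N v \<in> shuffles [N] v" "insert_at p N v' \<in> shuffles [N] v'"
    using m len by (simp_all add: insert_at_in_shuffles)
  have peaks12: "peaks (1 # 2 # r') = P" "peaks (2 # 1 # r') = P"
    using peaks_ins[OF peaks_v(1) max(1) len(1)] peaks_ins[OF peaks_v(2) max(2) len(2)] ins by simp_all
  have "st (insert_at p N v) = st (insert_at p N v')"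
    by (rule st_eq_if_least_peak_deleted[OF IH dis len in_sh])
      (use peaks12 ins peaks_v p in \<open>simp_all add: S_def\<close>)
  then have eq: "st (1 # 2 # r') = st (2 # 1 # r')" by (simp add: ins)
  have "is_permutation (1 # 2 # r')"
    using shuffles_permutation[OF dis(1) in_sh(1)] ins by simp
  then have dis1: "disjoint_perms [1] (2 # r')" "is_permutation (2 # r')"
    by (simp_all add: disjoint_perms_single is_permutation_Cons)
  have len1: "length (2 # r') = m"
    using len by (simp add: v_def r'_def)
  \<comment> \<open>Index 1 is not in \<open>P\<close>, so deleting the first letter loses no
    peak.\<close>
  have peaks_tl: "peaks u = {q. Suc q \<in> P}" if "peaks (y # u) = P" for y u
    using P[of "Suc 0"] peaks_Cons[of _ u y] that p(2,3) by auto
  have "st (y # u) = st (1 # 2 # r')"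
    if *: "is_permutation (y # u)" "length u = m" "peaks (y # u) = P" for y u
  proof -
    have perm: "is_permutation u" "disjoint_perms [y] u"
      using * by (simp_all add: disjoint_perms_single is_permutation_Cons)
    have "st u = st (2 # r')"
      using perm dis1 len1 * peaks_tl[OF *(3)] peaks_tl[OF peaks12(1)]
      by (intro peaks_determineD[OF IH]) simp_all
    have "image_mset st (mset_set {\<tau> \<in> shuffles [y] u. peaks \<tau> = P}) = {#st (1 # 2 # r'), st (2 # 1 # r')#}"
    proof (rule st_filter_two[OF determines_peaks_eq])
      show "k = 0 \<or> k = p" if "k \<le> length (2 # r')"
        "peaks (insert_at k (above (2 # r')) (2 # r')) = P" for k
        using peaks_insert_max_shift[OF _ that(1) peaks_tl[OF peaks12(1)] that(2) p(1,2)] above_greater by blast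
      show "1 # 2 # r' \<in> shuffles [1] (2 # r')" by (rule shuffles_Cons)
      show "2 # 1 # r' \<in> shuffles [1] (2 # r')" by (rule shuffles_swap)
    qed (use perm dis1 len1 * peaks12 \<open>st u = _\<close> in simp_all)
    moreover have "st (y # u) \<in># image_mset st (mset_set {\<tau> \<in> shuffles [y] u. peaks \<tau> = P})"
      using * by (auto simp: shuffles_Cons)
    ultimately show ?thesis using eq by auto
  qed
  then show ?thesis by blast
qed

lemma st_length_le_2:
  assumes "is_permutation \<pi>" "is_permutation \<sigma>" "length \<pi> = length \<sigma>" "length \<sigma> \<le> 2"
  shows "st \<pi> = st \<sigma>"
proof -
  consider "length \<sigma> = 0" | "length \<sigma> = 1" | "length \<sigma> = 2" using assms(4) by linarith
  then show ?thesis
  proof cases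
    case 1
    then show ?thesis using assms(3) by simp
  next
    case 2
    then obtain x y where "\<pi> = [x]" "\<sigma> = [y]"
      using assms(3) by (auto simp: length_Suc_conv)
    then show ?thesis using assms st_single[of x y] by (simp add: is_permutation_def)
  next
    case 3
    then show ?thesis using assms by (intro trivial_onD[OF trivial_on_2[OF pair]]) simp_all
  qed
qed

text \<open>Without peaks a maximal letter may go to either end, so every such word takes the value
  of \<open>id\<close> or of \<open>\<tau>\<close>. Describing the same pair of values by
  \<open>\<rho>\<close> and \<open>\<tau>\<close> gives \<open>st \<rho> = st id\<close>; passing to
  length \<open>m + 2\<close> and dropping the first letter gives
  \<open>st \<tau> = st id\<close>.\<close>

lemma st_eq_if_peaks_empty:
  assumes IH: "peaks_determine m" and m: "2 \<le> m"
  shows "\<exists>s. \<forall>z w. is_permutation (z # w) \<longrightarrow> length w = m \<longrightarrow> peaks (z # w) = {} \<longrightarrow> st (z # w) = s"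
proof -
  define id where "id = [1..<m + 2]"
  define r where "r = [4..<m + 2]"
  \<comment> \<open>\<open>\<tau>\<close> is a shuffle of 1 with \<open>2 # 3 # r\<close> as well as
    of 3 with \<open>2 # 1 # r\<close>, which links \<open>id\<close> to
    \<open>\<rho>\<close>.\<close>
  define \<tau> where "\<tau> = 2 # 1 # 3 # r"
  define \<rho> where "\<rho> = 3 # 2 # 1 # r"
  have id: "id = 1 # 2 # 3 # r"
    using m by (simp add: id_def r_def upt_conv_Cons numeral_eq_Suc)
  have r: "\<forall>z\<in>set r. 0 < z \<and> 1 < z \<and> 2 < z \<and> 3 < z" "distinct r" "sorted_wrt (<) r" "length r = m - 2"
    unfolding r_def by (rule sorted_wrt_upt | simp del: upt_Suc)+
  have perms: "is_permutation id" "is_permutation \<tau>" "is_permutation \<rho>"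
    using r(1,2) by (fastforce simp: id \<tau>_def \<rho>_def is_permutation_def)+
  have lens: "length id = Suc m" "length \<tau> = Suc m" "length \<rho> = Suc m"
    using m r by (simp_all add: id \<tau>_def \<rho>_def)
  have r': "\<forall>z\<in>set r. Suc 0 < z" using r(1) by simp
  have pk: "peaks id = {}" "peaks (2 # 3 # r) = {}" "peaks (2 # 1 # r) = {}" "peaks \<tau> = {}" "peaks \<rho> = {}"
    using r r' by (auto simp: id \<tau>_def \<rho>_def peaks_descent intro!: peaks_sorted)
  have two: "image_mset st (mset_set {\<tau> \<in> shuffles [z] w. peaks \<tau> = {}}) = {#st \<tau>1, st \<tau>2#}"
    if "is_permutation (z # w)" "length w = m" "peaks (z # w) = {}"
      "is_permutation (x # v)" "length v = m" "peaks v = {}"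
      "\<tau>1 \<in> shuffles [x] v" "\<tau>2 \<in> shuffles [x] v" "peaks \<tau>1 = {}" "peaks \<tau>2 = {}" "\<tau>1 \<noteq> \<tau>2"
    for z w x v \<tau>1 \<tau>2
  proof (rule st_filter_two[OF determines_peaks_eq])
    have "peaks w = {}" using peaks_Cons[of _ w z] that(3) by auto
    then show "st w = st v"
      using that by (intro peaks_determineD[OF IH]) (simp_all add: is_permutation_Cons)
    show "k = 0 \<or> k = length v" if "k \<le> length v" "peaks (insert_at k (above v) v) = {}" for k
      using peaks_insert_max_empty[OF _ that] above_greater by blast
    show "is_permutation v" "disjoint_perms [x] v" "disjoint_perms [z] w"
      using that by (simp_all add: is_permutation_Cons disjoint_perms_single)
  qed (use that in simp_all)
  have two_id: "image_mset st (mset_set {\<tau> \<in> shuffles [z] w. peaks \<tau> = {}}) = {#st id, st \<tau>#}"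
    if "is_permutation (z # w)" "length w = m" "peaks (z # w) = {}" for z w
    by (rule two[of _ _ 1 "2 # 3 # r"])
      (use that perms lens pk shuffles_Cons[of 1 "2 # 3 # r"] shuffles_swap[of 2 1 "3 # r"] in
        \<open>simp_all add: id \<tau>_def\<close>)
  have two_\<rho>: "image_mset st (mset_set {\<tau> \<in> shuffles [z] w. peaks \<tau> = {}}) = {#st \<rho>, st \<tau>#}"
    if "is_permutation (z # w)" "length w = m" "peaks (z # w) = {}" for z w
  proof (rule two[of _ _ 3 "2 # 1 # r"])
    show "\<tau> \<in> shuffles [3] (2 # 1 # r)"
      using insert_at_in_shuffles[of 2 "2 # 1 # r" 3] by (simp add: insert_at_def \<tau>_def)
  qed (use that perms lens pk shuffles_Cons[of 3 "2 # 1 # r"] in \<open>simp_all add: \<rho>_def \<tau>_def\<close>)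
  have \<rho>: "st \<rho> = st id"
    using two_id[of 1 "2 # 3 # r"] two_\<rho>[of 1 "2 # 3 # r"] perms lens pk by (simp add: id)
  have "st \<tau> = st id"
  proof (rule ccontr)
    assume ne: "st \<tau> \<noteq> st id"
    define N where "N = m + 2"
    have dis: "disjoint_perms [N] \<rho>" "disjoint_perms [N] id"
      using perms m by (auto simp: N_def disjoint_perms_single is_permutation_Cons id_def \<rho>_def r_def simp del: upt_Suc)
    have max: "\<forall>x\<in>set id. x < N" by (auto simp: id_def N_def)
    let ?M = "\<lambda>w. image_mset st (mset_set {\<tau> \<in> shuffles [N] w. peaks \<tau> = {}})"
    have "?M \<rho> = ?M id"
      by (rule shuffles_st_filter[OF dis]) (use \<rho> lens in \<open>simp_all add: determines_peaks_eq\<close>)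
    \<comment> \<open>The value of \<open>\<rho> @ [N]\<close> must occur among the peakless
      shuffles of \<open>N\<close> with \<open>id\<close>, which can only be \<open>N # id\<close>
      and \<open>id @ [N]\<close>. Dropping the first letter of these leaves a word ordered like
      \<open>id\<close>, whereas the tail of \<open>\<rho> @ [N]\<close> is ordered like
      \<open>\<tau>\<close>.\<close>
    moreover have "peaks (\<rho> @ [N]) = {}"
      using r by (auto simp: \<rho>_def peaks_descent N_def r_def sorted_wrt_append sorted_wrt_upt simp del: upt_Suc intro!: peaks_sorted)
    then have "st (\<rho> @ [N]) \<in># ?M \<rho>" by (simp add: shuffles_snoc)
    ultimately obtain \<sigma> where \<sigma>: "\<sigma> \<in> shuffles [N] id" "peaks \<sigma> = {}" "st (\<rho> @ [N]) = st \<sigma>" by auto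
    then obtain k where k: "k \<le> Suc m" "\<sigma> = insert_at k N id"
      using lens by (auto simp: shuffles_single)
    have "k = 0 \<or> k = Suc m"
      using peaks_insert_max_empty[OF max, of k] k \<sigma> lens by simp
    then have cases: "\<sigma> = N # id \<or> \<sigma> = id @ [N]"
      using k lens by (auto simp: insert_at_def)
    have perm_\<sigma>: "is_permutation \<sigma>" "length \<sigma> = m + 2"
      using shuffles_permutation[OF dis(2) \<sigma>(1)] lens by simp_all
    have perm_\<rho>: "is_permutation (\<rho> @ [N])" using shuffles_permutation(1)[OF dis(1) shuffles_snoc] .
    have "tl id @ [N] = [Suc 1..<m + 2] @ [m + 2]" by (simp add: id_def N_def tl_upt del: upt_Suc)
    also have "\<dots> = [Suc 1..<Suc (m + 2)]" by (rule upt_Suc_append[symmetric]) simp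
    finally have map_id: "tl id @ [N] = map Suc id" by (simp only: id_def map_Suc_upt)
    have shift: "st (tl id @ [N]) = st id" unfolding map_id
      by (intro st_order same_relative_order_map) (use perms in \<open>auto simp: is_permutation_def distinct_map\<close>)
    have "3 # r = [3..<m + 2]"
      using upt_conv_Cons[of 3 "m + 2"] m by (simp add: r_def del: upt_Suc)
    then have "map Suc (3 # r) = [Suc 3..<Suc (m + 2)]" by (simp only: map_Suc_upt)
    also have "\<dots> = [Suc 3..<m + 2] @ [m + 2]" by (rule upt_Suc_append) (use m in simp)
    finally have "map Suc (3 # r) = r @ [N]" by (simp add: r_def N_def del: upt_Suc)
    moreover have "map (\<lambda>x. if 3 \<le> x then Suc x else x) r = map Suc r"
      by (rule map_cong) (use r(1) in \<open>auto simp: not_le\<close>)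
    ultimately have map_\<tau>: "tl (\<rho> @ [N]) = map (\<lambda>x. if 3 \<le> x then Suc x else x) \<tau>"
      by (simp add: \<rho>_def \<tau>_def del: map_eq_conv)
    have "st (tl (\<rho> @ [N])) = st \<tau>"
      unfolding map_\<tau> using perms(2)
      by (intro st_order same_relative_order_map)
        (auto simp: is_permutation_def distinct_map inj_on_def split: if_splits)
    moreover have "st (take (Suc m) (drop 1 (\<rho> @ [N]))) = st (take (Suc m) (drop 1 \<sigma>))"
      by (rule st_window) (use perm_\<rho> perm_\<sigma> \<sigma> lens in simp_all)
    then have "st (tl (\<rho> @ [N])) = st (tl \<sigma>)"
      using lens perm_\<sigma> by (simp add: drop_Suc \<rho>_def)
    moreover have "tl \<sigma> = id \<or> tl \<sigma> = tl id @ [N]" using cases by (auto simp: id)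
    then have "st (tl \<sigma>) = st id" using shift by auto
    ultimately show False using ne by simp
  qed
  then have "st (z # w) = st id" if "is_permutation (z # w)" "length w = m" "peaks (z # w) = {}" for z w
  proof -
    have "st (z # w) \<in># image_mset st (mset_set {\<tau> \<in> shuffles [z] w. peaks \<tau> = {}})"
      using that by (auto simp: shuffles_Cons)
    then show ?thesis using two_id[OF that] \<open>st \<tau> = st id\<close> by auto
  qed
  then show ?thesis by blast
qed

lemma peaks_determine_all: "peaks_determine n"
proof (induction n)
  case 0
  then show ?case by (simp add: peaks_determine_def)
next
  case (Suc m)
  show ?case unfolding peaks_determine_def
  proof (intro allI impI)
    fix \<pi> \<sigma> :: "nat list"
    assume *: "is_permutation \<pi>" "is_permutation \<sigma>" "length \<pi> = Suc m" "length \<sigma> = Suc m" "peaks \<pi> = peaks \<sigma>"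
    from *(3,4) obtain x v y w where xy: "\<pi> = x # v" "\<sigma> = y # w" by (auto simp: length_Suc_conv)
    consider "m < 2" | "2 \<le> m" "peaks \<pi> = {}" | "peaks \<pi> \<noteq> {}" by linarith
    then show "st \<pi> = st \<sigma>"
    proof cases
      case 1
      then show ?thesis using * by (intro st_length_le_2) simp_all
    next
      case 2
      then obtain s where "\<forall>z w. is_permutation (z # w) \<longrightarrow> length w = m \<longrightarrow> peaks (z # w) = {} \<longrightarrow> st (z # w) = s"
        using st_eq_if_peaks_empty[OF Suc] by blast
      moreover have "length v = m" "length w = m" using * xy by simp_all
      ultimately have "st (x # v) = s" "st (y # w) = s" using * 2(2) unfolding xy by metis+
      then show ?thesis using xy by simp
    next
      case 3
      define p where "p = (LEAST q. q \<in> peaks \<pi>)"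
      have p: "p \<in> peaks \<pi>" "\<forall>q\<in>peaks \<pi>. p \<le> q"
        using 3 by (auto simp: p_def intro: LeastI Least_le)
      have "0 < p" using p(1) by (simp add: peaks_def)
      show ?thesis
      proof (cases "p = 1")
        case True
        \<comment> \<open>A peak at index 1 is destroyed by deleting the first letter, so at most
          one insertion recovers the peak set; a later least peak survives the deletion and needs
          the argument with two values.\<close>
        show ?thesis unfolding xy
        proof (rule st_eq_if_least_peak_deleted[OF Suc, where P = "peaks \<pi>" and p = 1])
          show "x # v \<in> shuffles [x] v" "y # w \<in> shuffles [y] w" by (rule shuffles_Cons)+
          show "peaks v = {q. Suc q \<in> peaks \<pi> \<and> 1 \<le> q}"
            unfolding xy by (rule peaks_eq_Cons)
          show "peaks w = {q. Suc q \<in> peaks \<pi> \<and> 1 \<le> q}"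
            using *(5) peaks_eq_Cons[of w y] xy by simp
        qed (use * xy p True in \<open>simp_all add: disjoint_perms_single\<close>)
      next
        case False
        then have "2 \<le> p" using \<open>0 < p\<close> by simp
        have "length w = m" using * xy by simp
        have "is_permutation (x # v)" "length v = m" "peaks (x # v) = peaks \<pi>" using * xy by simp_all
        from st_eq_if_peaks_eq_late[OF Suc this p \<open>2 \<le> p\<close>] obtain s where
          "\<forall>z w. is_permutation (z # w) \<longrightarrow> length w = m \<longrightarrow> peaks (z # w) = peaks \<pi> \<longrightarrow> st (z # w) = s" by blast
        then have "st (x # v) = s" "st (y # w) = s" using * xy \<open>length v = m\<close> \<open>length w = m\<close> by blast+
        then show ?thesis using xy by simp
      qed
    qed
  qed
qed

lemma st_equiv_Pk: "st_equiv st Pk"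
  unfolding st_equiv_def st_sim_def Pk_eq_iff
proof (intro allI impI)
  fix \<pi> \<sigma>
  assume "is_permutation \<pi>" "is_permutation \<sigma>"
  then show "(length \<pi> = length \<sigma> \<and> st \<pi> = st \<sigma>) \<longleftrightarrow> (length \<pi> = length \<sigma> \<and> peaks \<pi> = peaks \<sigma>)"
    using peaks_determineD[OF peaks_determine_all] determinesD[OF determines_peaks[OF pair peak]] by blast
qed

end

end


section \<open>Complements and valleys\<close>

definition complement :: "nat list \<Rightarrow> nat list" where
  "complement w = map ((-) (above w)) w"

lemma length_complement [simp]: "length (complement w) = length w"
  by (simp add: complement_def)

lemma is_permutation_map_minus:
  "is_permutation w \<Longrightarrow> \<forall>x\<in>set w. x < M \<Longrightarrow> is_permutation (map ((-) M) w)"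
  by (auto simp: is_permutation_def distinct_map inj_on_def)

lemma is_permutation_complement: "is_permutation w \<Longrightarrow> is_permutation (complement w)"
  unfolding complement_def using above_greater by (intro is_permutation_map_minus) auto

lemma complement_nth_less_iff:
  assumes "i < length w" "j < length w"
  shows "complement w ! i < complement w ! j \<longleftrightarrow> w ! j < w ! i"
  using above_greater[of "w ! i" w] above_greater[of "w ! j" w] assms by (auto simp: complement_def)

lemma same_relative_order_complement:
  "same_relative_order \<pi> \<sigma> \<Longrightarrow> same_relative_order (complement \<pi>) (complement \<sigma>)"
  by (simp add: same_relative_order_def complement_nth_less_iff)

lemma same_relative_order_complement2: "same_relative_order (complement (complement w)) w"
  by (simp add: same_relative_order_def complement_nth_less_iff)

lemma same_relative_order_map_minus:
  assumes "\<forall>x\<in>set w. x < M"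
  shows "same_relative_order (complement w) (map ((-) M) w)"
proof -
  have "map ((-) M) w ! i < map ((-) M) w ! j \<longleftrightarrow> w ! j < w ! i" if "i < length w" "j < length w" for i j
    using that assms nth_mem[of i w] nth_mem[of j w] by fastforce
  then show ?thesis by (simp add: same_relative_order_def complement_nth_less_iff)
qed

lemma Pk_complement: "Pk (complement w) = Val w"
proof -
  have "2 \<le> i \<and> i \<le> length w - 1 \<Longrightarrow> i - 2 < length w \<and> i - 1 < length w \<and> i < length w" for i by auto
  then show ?thesis by (auto simp: Pk_def Val_def complement_nth_less_iff)
qed

lemma shuffles_map: "shuffles (map f u) (map f w) = map f ` shuffles u w"
  by (induction u w rule: shuffles.induct) (simp_all add: image_Un image_image)

context bicompatible_statistic
begin

text \<open>Any bound reverses the order in the same way; this allows one bound for a whole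
  shuffle.\<close>

lemma st_map_minus:
  "is_permutation w \<Longrightarrow> \<forall>x\<in>set w. x < M \<Longrightarrow> st (complement w) = st (map ((-) M) w)"
  by (intro st_order same_relative_order_map_minus is_permutation_complement is_permutation_map_minus)

text \<open>Both compatibilities transfer once complements are taken with one bound for all words of
  a shuffle, or for a word and its substrings: that map is injective on the letters and commutes
  with \<open>shuffles\<close> and with windows.\<close>

lemma bicompatible_statistic_complement: "bicompatible_statistic (\<lambda>w. st (complement w))"
proof
  show "permutation_statistic (\<lambda>w. st (complement w))"
    unfolding permutation_statistic_def
    by (intro allI impI st_order is_permutation_complement same_relative_order_complement)
  have "shuffle_compatible (\<lambda>w. st (complement w))"
    unfolding shuffle_compatible_def
  proof (intro allI impI)
    fix \<pi> \<sigma> \<pi>' \<sigma>' :: "nat list"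
    assume dis: "disjoint_perms \<pi> \<sigma>" "disjoint_perms \<pi>' \<sigma>'"
      and st: "st (complement \<pi>) = st (complement \<pi>')" "st (complement \<sigma>) = st (complement \<sigma>')"
      and len: "length \<pi> = length \<pi>'" "length \<sigma> = length \<sigma>'"
    have less: "\<forall>x\<in>set u. x < above (u @ w)" "\<forall>x\<in>set w. x < above (u @ w)" for u w
      using above_greater[of _ "u @ w"] by auto
    have dis_map: "disjoint_perms (map ((-) (above (u @ w))) u) (map ((-) (above (u @ w))) w)"
      if "disjoint_perms u w" for u w
      using that is_permutation_map_minus[of "u @ w" "above (u @ w)"] above_greater
      by (auto simp: disjoint_perms_append)
    have map: "image_mset (\<lambda>w. st (complement w)) (mset_set (shuffles u w)) =
      image_mset st (mset_set (shuffles (map ((-) (above (u @ w))) u) (map ((-) (above (u @ w))) w)))"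
      if uw: "disjoint_perms u w" for u w
    proof -
      let ?g = "(-) (above (u @ w))"
      have set: "set \<tau> \<subseteq> set (u @ w)" if "\<tau> \<in> shuffles u w" for \<tau>
        using set_shuffles[OF that] by simp
      have "inj_on ?g (set (u @ w))"
      proof (rule inj_onI)
        fix x y assume "x \<in> set (u @ w)" "y \<in> set (u @ w)" "?g x = ?g y"
        then show "x = y" using above_greater[of x "u @ w"] above_greater[of y "u @ w"] by simp
      qed
      then have "inj_on (map ?g) (shuffles u w)"
        using set by (intro inj_onI) (metis (no_types, lifting) Un_subset_iff inj_on_map_eq_map inj_on_subset)
      moreover have "st (complement \<tau>) = st (map ?g \<tau>)" if "\<tau> \<in> shuffles u w" for \<tau>
        using shuffles_permutation[OF uw that] set[OF that] above_greater[of _ "u @ w"]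
        by (intro st_map_minus) auto
      then have "image_mset (\<lambda>w. st (complement w)) (mset_set (shuffles u w)) =
          image_mset st (image_mset (map ?g) (mset_set (shuffles u w)))"
        unfolding image_mset.compositionality by (intro image_mset_cong) simp
      ultimately show ?thesis
        by (simp add: shuffles_map image_mset_mset_set)
    qed
    have perm: "is_permutation \<pi>" "is_permutation \<sigma>" "is_permutation \<pi>'" "is_permutation \<sigma>'"
      using dis by (simp_all add: disjoint_perms_def)
    show "image_mset (\<lambda>w. st (complement w)) (mset_set (shuffles \<pi> \<sigma>)) =
      image_mset (\<lambda>w. st (complement w)) (mset_set (shuffles \<pi>' \<sigma>'))"
      unfolding map[OF dis(1)] map[OF dis(2)]
      by (rule shuffles_st[OF dis_map[OF dis(1)] dis_map[OF dis(2)]])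
        (use st len in \<open>simp_all flip: st_map_minus[OF perm(1) less(1)] st_map_minus[OF perm(2) less(2)]
          st_map_minus[OF perm(3) less(1)] st_map_minus[OF perm(4) less(2)]\<close>)
  qed
  moreover have "substring_compatible (\<lambda>w. st (complement w))"
    unfolding substring_compatible_def st_sim_def
  proof (intro allI impI)
    fix \<pi> \<sigma> :: "nat list" and i j
    assume perm: "is_permutation \<pi>" "is_permutation \<sigma>"
      and eq: "length \<pi> = length \<sigma> \<and> st (complement \<pi>) = st (complement \<sigma>)"
      and ij: "1 \<le> i" "i \<le> j" "j \<le> length \<pi>"
    have *: "st (complement (substring w i j)) = st (take (j - i + 1) (drop (i - 1) (complement w)))"
      if "is_permutation w" for w
      unfolding substring_def complement_def[of w] drop_map take_map
      using that above_greater[of _ w]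
      by (intro st_map_minus is_permutation_take is_permutation_drop)
        (auto dest!: in_set_takeD in_set_dropD)
    show "length (substring \<pi> i j) = length (substring \<sigma> i j) \<and>
      st (complement (substring \<pi> i j)) = st (complement (substring \<sigma> i j))"
    proof
      show "length (substring \<pi> i j) = length (substring \<sigma> i j)"
        using eq by (simp add: substring_def)
      show "st (complement (substring \<pi> i j)) = st (complement (substring \<sigma> i j))"
        unfolding *[OF perm(1)] *[OF perm(2)]
        by (rule st_window) (use perm eq ij in \<open>simp_all add: is_permutation_complement\<close>)
    qed
  qed
  ultimately show "bicompatible (\<lambda>w. st (complement w))" by (simp add: bicompatible_def)
qed

lemma st_equiv_Val:
  assumes "st [1, 2] = st [2, 1]" "st [2, 1, 3] \<noteq> st [1, 2, 3]" "st [2, 1, 3] \<noteq> st [1, 3, 2]"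
  shows "st_equiv st Val"
proof -
  interpret c: bicompatible_statistic "\<lambda>w. st (complement w)" by (rule bicompatible_statistic_complement)
  have "complement [1, 2] = [2, 1]" "complement [2, 1] = [1, 2]" "complement [1, 3, 2] = [3, 1, 2]"
    "complement [1, 2, 3] = [3, 2, 1]" "complement [2, 1, 3] = [2, 3, 1]"
    by (simp_all add: complement_def above_def)
  \<comment> \<open>The words 132, 123, 213 become 312, 321, 231, whose values are those of 213,
    123, 132; so the assumptions turn into the conditions for peaks.\<close>
  then have Pk: "st_equiv (\<lambda>w. st (complement w)) Pk"
    using assms st_length_3_eqs[OF assms(1)] by (intro c.st_equiv_Pk) simp_all
  show ?thesis unfolding st_equiv_def
  proof (intro allI impI)
    fix \<pi> \<sigma> assume perm: "is_permutation \<pi>" "is_permutation \<sigma>"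
    have twice: "st (complement (complement w)) = st w" if "is_permutation w" for w
      by (rule st_order) (simp_all add: that is_permutation_complement same_relative_order_complement2)
    have "st_sim (\<lambda>w. st (complement w)) (complement \<pi>) (complement \<sigma>) \<longleftrightarrow> st_sim Pk (complement \<pi>) (complement \<sigma>)"
      using Pk is_permutation_complement perm unfolding st_equiv_def by blast
    then show "st_sim st \<pi> \<sigma> \<longleftrightarrow> st_sim Val \<pi> \<sigma>"
      by (simp add: st_sim_def Pk_complement twice perm)
  qed
qed

text \<open>Excluding \<open>Pk\<close> and \<open>Val\<close> leaves two options: the values of
  123, 132 and 213 are all equal, or those of 132 and 213 agree and differ from that of 123. The
  second one is refuted in length 4.\<close>

lemma trivial_on_3:
  assumes pair: "st [1, 2] = st [2, 1]" and "\<not> st_equiv st Pk" "\<not> st_equiv st Val"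
  shows "trivial_on 3"
proof -
  have "st [1, 3, 2] = st [2, 1, 3] \<or> st [1, 3, 2] = st [1, 2, 3]"
    using st_equiv_Pk[OF pair] assms(2) by metis
  moreover have "st [2, 1, 3] = st [1, 2, 3] \<or> st [2, 1, 3] = st [1, 3, 2]"
    using st_equiv_Val[OF pair] assms(3) by metis
  moreover have False if bc: "st [1, 3, 2] = st [2, 1, 3]" "st [1, 3, 2] \<noteq> st [1, 2, 3]"
  proof -
    \<comment> \<open>Some shuffle of 12 with 43 must share the value of 1234. Both its windows of
      length 3 would then be monotone, hence the whole word, although it contains 12 and 43 as
      subsequences.\<close>
    have "mset (map st (shuf [1, 2] [3, 4])) = mset (map st (shuf [1, 2] [4, 3]))"
      by (rule shuf_st_image, simp_all add: disjoint_perms_append is_permutation_def determines_st)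
        (rule trivial_onD[OF trivial_on_2[OF pair]], simp_all add: is_permutation_def)
    then have "set (map st (shuf [1, 2] [3, 4])) = set (map st (shuf [1, 2] [4, 3]))"
      by (rule mset_eq_setD)
    moreover have "st [1, 2, 3, 4] \<in> set (map st (shuf [1, 2] [3, 4]))" by simp
    ultimately have "st [1, 2, 3, 4] \<in> st ` set (shuf [1, 2] [4, 3])" by (metis set_map)
    then obtain \<tau> where \<tau>: "\<tau> \<in> set (shuf [1, 2] [4, 3])" "st [1, 2, 3, 4] = st \<tau>" by blast
    have *: "is_permutation \<tau> \<and> length \<tau> = 4" using \<tau>(1) by (auto simp: is_permutation_def)
    have "st (take 3 (drop i [1, 2, 3, 4])) = st (take 3 (drop i \<tau>))" if "i \<le> 1" for i
      by (rule st_window) (use * that \<tau>(2) in \<open>simp_all add: is_permutation_def\<close>)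
    from this[of 0] this[of 1]
    have "st (take 3 \<tau>) = st [1, 2, 3]" "st (take 3 (drop 1 \<tau>)) = st [2, 3, 4]" by simp_all
    moreover have "st [2, 3, 4] = st [1, 2, 3]"
      using st_triple[OF pair, of 2 3 4] by (simp add: is_permutation_def)
    moreover have "st [x, y, z] = st [1, 2, 3] \<longleftrightarrow> \<not> (x < y \<and> z < y) \<and> \<not> (y < x \<and> y < z)"
      if "is_permutation [x, y, z]" for x y z
      using st_triple[OF pair that] bc by (simp split: if_splits)
    ultimately show False
      using \<tau>(1) by (auto simp: is_permutation_def)
  qed
  ultimately have *: "st [1, 3, 2] = st [1, 2, 3]" "st [2, 1, 3] = st [1, 2, 3]" by metis+
  have "st w = st [1, 2, 3]" if "is_permutation w" "length w = 3" for w
  proof -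
    from that(2) obtain x y z where w: "w = [x, y, z]"
      by (auto simp: length_Suc_conv numeral_3_eq_3)
    show ?thesis using st_triple[OF pair, of x y z] that(1) * unfolding w by simp
  qed
  from this this[symmetric] show ?thesis unfolding trivial_on_def by metis
qed

end


section \<open>Case trees refuting a class\<close>

definition standardize :: "nat list \<Rightarrow> nat list" where
  "standardize w = map (\<lambda>x. Suc (length (filter (\<lambda>y. y < x) w))) w"

definition windows :: "nat \<Rightarrow> nat list \<Rightarrow> nat list \<Rightarrow> nat list list" where
  "windows n ks \<tau> = map (\<lambda>k. standardize (take n (drop k \<tau>))) ks"

text \<open>With \<open>pos\<close> known to be inside the class and \<open>neg\<close> outside,
  this counts the entries that certainly hit and the next definition those not yet excluded.\<close>

definition lower_bound :: "nat list list \<Rightarrow> nat list list list \<Rightarrow> nat" where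
  "lower_bound pos ts = length (filter (list_all (\<lambda>w. w \<in> set pos)) ts)"

definition upper_bound :: "nat list list \<Rightarrow> nat list list list \<Rightarrow> nat" where
  "upper_bound neg ts = length (filter (list_all (\<lambda>w. w \<notin> set neg)) ts)"

text \<open>
  A refutation branches on whether a standardized word lies in the class. Its leaves are shuffles
  whose number of words with all windows at the offsets \<open>ks\<close> in the class is above (\<open>Over\<close>) or below
  (\<open>Under\<close>) the value prescribed by \<open>K\<close>, or pairs of shuffles whose numbers should agree by \<open>D\<close> but differ.
\<close>

datatype refutation =
    Split "nat list" refutation refutation
  | Over "nat list" "nat list" "nat list"
  | Under "nat list" "nat list" "nat list"
  | Differ "nat list" "nat list" "nat list" "nat list" "nat list"

text \<open>Window offsets, followed by the lengths of the two shuffled words.\<close>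

type_synonym shape = "nat list \<times> nat \<times> nat"

text \<open>\<open>K\<close> lists shapes with a known count, \<open>D\<close> shapes whose count is
  constant but unknown; hence \<open>Differ\<close> compares two shuffles of the same shape.\<close>

primrec refutes :: "nat \<Rightarrow> (shape \<times> nat) list \<Rightarrow> shape list \<Rightarrow> nat list list \<Rightarrow> nat list list \<Rightarrow>
    refutation \<Rightarrow> bool" where
  "refutes n K D pos neg (Split w r s) \<longleftrightarrow> refutes n K D (w # pos) neg r \<and> refutes n K D pos (w # neg) s"
| "refutes n K D pos neg (Over ks u w) \<longleftrightarrow> is_permutation (u @ w) \<and>
    (case map_of K (ks, length u, length w) of None \<Rightarrow> False
     | Some c \<Rightarrow> c < lower_bound pos (map (windows n ks) (shuf u w)))"
| "refutes n K D pos neg (Under ks u w) \<longleftrightarrow> is_permutation (u @ w) \<and>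
    (case map_of K (ks, length u, length w) of None \<Rightarrow> False
     | Some c \<Rightarrow> upper_bound neg (map (windows n ks) (shuf u w)) < c)"
| "refutes n K D pos neg (Differ ks u w u' w') \<longleftrightarrow> is_permutation (u @ w) \<and> is_permutation (u' @ w') \<and>
    length u = length u' \<and> length w = length w' \<and> (ks, length u, length w) \<in> set D \<and>
    upper_bound neg (map (windows n ks) (shuf u' w')) < lower_bound pos (map (windows n ks) (shuf u w))"

text \<open>The trees were found by computer search.\<close>

definition refutation_length_4 :: refutation where
  "refutation_length_4 =
    Split [2,1,3,4] (Split [2,3,1,4] (Over [0] [1] [2,3,4]) (Split [2,3,4,1] (Over [0] [1] [2,3,4]) (Split
    [1,3,2,4] (Over [0] [2] [1,3,4]) (Split [1,3,4,2] (Over [0] [2] [1,3,4]) (Split [3,1,2,4] (Split [1,2,4,3]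
    (Over [0] [3] [1,2,4]) (Split [2,1,4,3] (Split [3,2,1,4] (Over [0] [3] [2,1,4]) (Differ [0,1] [2,3]
    [1,4,5] [3,1] [2,4,5])) (Split [2,4,1,3] (Differ [0,2] [2,4,6] [1,3,5] [2,5,4] [1,3,6]) (Under [0] [1]
    [2,4,3])))) (Split [1,2,4,3] (Differ [0,1] [2,5] [1,3,4] [3,2] [1,4,5]) (Under [0] [3] [1,2,4])))))))
    (Split [2,3,1,4] (Split [2,3,4,1] (Over [0] [1] [2,3,4]) (Split [1,3,2,4] (Split [1,3,4,2] (Over [0] [2]
    [1,3,4]) (Split [3,1,2,4] (Over [0] [3] [1,2,4]) (Split [3,2,1,4] (Split [3,1,4,2] (Over [0] [2] [3,1,4])
    (Split [1,4,2,3] (Split [4,1,2,3] (Over [0] [4] [1,2,3]) (Differ [0,2] [1,4,5] [2,3,6] [4,1,3] [2,5,6]))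
    (Under [0] [3] [1,4,2]))) (Split [2,1,4,3] (Differ [0,1] [1,4] [2,3,5] [2,1] [3,4,5]) (Under [0] [3]
    [2,1,4]))))) (Split [1,3,4,2] (Split [3,1,2,4] (Split [3,2,1,4] (Over [0] [2] [3,1,4]) (Differ [0,1] [3,4]
    [1,2,5] [2,1] [3,4,5])) (Split [3,2,1,4] (Split [1,2,4,3] (Split [3,1,4,2] (Over [0] [2] [3,1,4]) (Differ
    [0,2] [2,1,6] [3,4,5] [1,5,6] [3,2,4])) (Under [0] [3] [1,2,4])) (Under [0] [1] [3,2,4]))) (Under [0] [2]
    [1,3,4])))) (Split [2,3,4,1] (Split [3,2,1,4] (Split [1,3,2,4] (Split [3,2,4,1] (Over [0] [1] [3,2,4])
    (Split [3,4,2,1] (Split [4,3,2,1] (Over [0] [4] [3,2,1]) (Differ [0,1] [2,1] [3,4,5] [4,5] [3,2,1]))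
    (Under [0] [2,1] [3,4]))) (Split [1,3,4,2] (Split [3,1,2,4] (Split [1,2,4,3] (Over [0] [3] [1,2,4]) (Split
    [1,4,2,3] (Split [4,1,2,3] (Over [0] [4] [1,2,3]) (Differ [0,1] [2,3] [1,4,5] [2,5] [1,3,4])) (Under [0]
    [1,4] [2,3]))) (Split [3,2,4,1] (Split [3,4,2,1] (Over [0] [2] [3,4,1]) (Differ [0,1] [1,2] [3,4,5] [2,1]
    [3,4,5])) (Under [0] [1] [3,2,4]))) (Under [0] [2] [1,3,4]))) (Under [0] [3] [2,1,4])) (Under [0] [1]
    [2,3,4])))"

definition refutation_length_5_density_1 :: refutation where
  "refutation_length_5_density_1 =
    Split [1,2,3,4,5] (Over [0,1] [] [1,2,3,4,5,6]) (Split [2,1,3,4,5] (Split [1,2,3,5,4] (Over [0,1] []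
    [2,1,3,4,6,5]) (Split [2,3,4,5,1] (Over [0,1] [] [3,2,4,5,6,1]) (Split [1,2,4,5,3] (Over [0,1] []
    [2,1,3,5,6,4]) (Split [1,3,2,4,5] (Over [0,1] [] [1,3,2,4,5,6]) (Split [1,3,4,5,2] (Over [0,1] []
    [2,1,4,5,6,3]) (Split [3,2,1,4,5] (Over [0,1] [] [3,2,1,4,5,6]) (Split [2,3,1,4,5] (Over [0,1] []
    [2,3,1,4,5,6]) (Split [2,3,4,1,5] (Over [0] [1] [2,3,4,5]) (Split [1,3,4,2,5] (Over [0] [2] [1,3,4,5])
    (Split [2,1,4,3,5] (Over [0] [3] [2,1,4,5]) (Split [2,4,1,3,5] (Over [0] [4] [2,1,3,5]) (Split [2,1,3,5,4]
    (Over [0] [4] [2,1,3,5]) (Split [2,5,1,3,4] (Over [0] [5] [2,1,3,4]) (Split [3,1,2,4,5] (Split [1,4,2,3,5]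
    (Over [0,1] [] [1,4,2,3,5,6]) (Split [4,3,1,2,5] (Over [0,1] [] [4,3,1,2,5,6]) (Split [3,2,4,1,5] (Over
    [0] [1] [3,2,4,5]) (Split [3,2,4,5,1] (Over [0] [1] [3,2,4,5]) (Split [1,2,4,3,5] (Over [0] [3] [1,2,4,5])
    (Split [3,1,5,2,4] (Over [0] [5] [3,1,2,4]) (Split [4,1,2,3,5] (Split [1,5,2,3,4] (Over [0,1] []
    [1,5,2,3,4,6]) (Split [4,1,3,2,5] (Over [0] [2] [4,1,3,5]) (Split [4,1,2,5,3] (Over [0] [3] [4,1,2,5])
    (Split [4,1,5,2,3] (Over [0] [5] [4,1,2,3]) (Split [2,4,3,1,5] (Split [4,2,1,5,3] (Over [0,1] []
    [2,5,3,1,6,4]) (Split [4,3,2,5,1] (Over [0,1] [] [3,5,4,2,6,1]) (Split [4,3,2,1,5] (Over [0] [2]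
    [4,3,1,5]) (Split [2,4,1,5,3] (Over [0] [3] [2,4,1,5]) (Split [1,4,3,2,5] (Split [4,1,5,3,2] (Over [0,1]
    [] [4,1,5,3,2,6]) (Under [0] [2] [4,1,5,3])) (Under [0] [1] [4,3,2,5])))))) (Split [2,4,3,5,1] (Split
    [2,4,1,5,3] (Split [4,2,5,1,3] (Over [0,1] [] [2,5,3,6,1,4]) (Split [2,4,5,3,1] (Over [0] [3] [2,4,5,1])
    (Split [2,4,5,1,3] (Over [0] [3] [2,4,5,1]) (Split [4,2,5,3,1] (Over [0,1] [] [3,5,2,6,4,1]) (Split
    [4,2,1,5,3] (Over [0] [2] [4,1,5,3]) (Split [2,5,4,1,3] (Over [0] [5] [2,4,1,3]) (Split [1,4,2,5,3] (Split
    [2,5,1,4,3] (Split [1,2,5,3,4] (Over [0] [4] [1,2,5,3]) (Differ [0,2] [2,3,7] [5,1,6,4] [3,1,7]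
    [2,4,5,6])) (Under [0] [4] [2,5,1,3])) (Under [0] [1] [4,2,5,3])))))))) (Under [0] [3] [2,4,1,5])) (Under
    [0] [1] [2,4,3,5]))))))) (Under [0] [4] [1,2,3,5])))))))) (Split [1,2,4,3,5] (Split [1,3,2,5,4] (Over
    [0,1] [] [1,2,4,3,6,5]) (Split [1,4,2,5,3] (Over [0,1] [] [1,2,5,3,6,4]) (Split [3,1,2,5,4] (Over [0,1] []
    [3,1,2,5,4,6]) (Split [2,4,3,1,5] (Over [0] [1] [2,4,3,5]) (Split [1,4,2,3,5] (Over [0] [2] [1,4,3,5])
    (Split [1,4,3,2,5] (Over [0] [2] [1,4,3,5]) (Split [4,1,2,3,5] (Over [0] [4] [1,2,3,5]) (Split [3,1,4,2,5]
    (Split [2,4,1,5,3] (Over [0,1] [] [2,4,1,5,3,6]) (Split [3,4,1,5,2] (Over [0,1] [] [3,4,1,5,2,6]) (Split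
    [3,4,1,2,5] (Over [0] [1] [3,4,2,5]) (Split [3,2,4,1,5] (Split [2,3,1,5,4] (Over [0,1] [] [3,2,4,1,6,5])
    (Split [3,2,1,5,4] (Over [0] [4] [3,2,1,5]) (Split [3,2,5,4,1] (Over [0] [5] [3,2,4,1]) (Split [3,2,5,1,4]
    (Split [2,3,5,1,4] (Over [0] [2] [3,5,1,4]) (Differ [0,2] [3,5,7] [1,4,2,6] [1,2,6] [3,4,5,7])) (Under [0]
    [1] [3,2,5,4]))))) (Under [0] [3] [2,4,1,5]))))) (Under [0] [3] [1,4,2,5]))))))))) (Under [0] [3]
    [1,2,4,5])))))))))))))))) (Split [2,3,1,4,5] (Split [1,3,4,2,5] (Over [0,1] [] [1,3,4,2,5,6]) (Split
    [5,2,3,1,4] (Over [0,1] [] [5,2,3,1,4,6]) (Split [2,1,3,5,4] (Over [0,1] [] [2,3,1,4,6,5]) (Split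
    [3,2,4,1,5] (Over [0,1] [] [3,2,4,1,5,6]) (Split [2,1,4,5,3] (Over [0,1] [] [2,3,1,5,6,4]) (Split
    [3,2,4,5,1] (Over [0,1] [] [3,4,2,5,6,1]) (Split [3,2,1,4,5] (Over [0] [2] [3,1,4,5]) (Split [3,1,2,4,5]
    (Over [0] [2] [3,1,4,5]) (Split [3,1,4,2,5] (Over [0] [2] [3,1,4,5]) (Split [2,1,4,3,5] (Over [0] [3]
    [2,1,4,5]) (Split [2,3,1,5,4] (Over [0] [4] [2,3,1,5]) (Split [2,3,5,1,4] (Over [0] [5] [2,3,1,4]) (Split
    [1,3,2,4,5] (Split [1,2,4,3,5] (Over [0,1] [] [1,2,4,3,5,6]) (Split [1,3,4,5,2] (Over [0] [2] [1,3,4,5])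
    (Split [1,2,4,5,3] (Over [0] [3] [1,2,4,5]) (Split [1,4,3,2,5] (Over [0] [4] [1,3,2,5]) (Split [1,3,2,5,4]
    (Over [0] [4] [1,3,2,5]) (Split [1,5,3,2,4] (Over [0] [5] [1,3,2,4]) (Split [1,3,5,2,4] (Over [0] [5]
    [1,3,2,4]) (Split [1,2,3,5,4] (Split [5,1,2,3,4] (Over [0,1] [] [6,1,2,3,5,4]) (Split [1,3,5,4,2] (Over
    [0,1] [] [1,2,4,6,5,3]) (Split [1,4,2,3,5] (Over [0] [4] [1,2,3,5]) (Split [1,5,2,3,4] (Over [0] [5]
    [1,2,3,4]) (Split [1,4,3,5,2] (Split [1,4,2,5,3] (Split [1,4,5,3,2] (Over [0] [3] [1,4,5,2]) (Split
    [1,4,5,2,3] (Over [0] [3] [1,4,5,2]) (Split [5,1,4,3,2] (Over [0] [5] [1,4,3,2]) (Split [1,5,4,3,2] (Over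
    [0] [5] [1,4,3,2]) (Split [3,1,5,2,4] (Over [0,1] [] [1,4,2,6,3,5]) (Split [5,1,4,2,3] (Over [0] [5]
    [1,4,2,3]) (Split [1,5,4,2,3] (Over [0] [5] [1,4,2,3]) (Split [1,5,2,4,3] (Split [5,1,2,4,3] (Over [0] [1]
    [5,2,4,3]) (Split [5,2,1,4,3] (Over [0] [1] [5,2,4,3]) (Split [2,5,1,4,3] (Split [2,5,1,3,4] (Over [0] [3]
    [2,5,1,4]) (Differ [0,2] [2,7,3] [1,6,5,4] [1,5,3] [7,2,4,6])) (Under [0] [2] [5,1,4,3])))) (Under [0] [3]
    [1,5,2,4]))))))))) (Under [0] [3] [1,4,2,5])) (Under [0] [2] [1,4,3,5])))))) (Split [2,3,5,4,1] (Split
    [1,3,5,4,2] (Split [1,4,3,5,2] (Over [0] [4] [1,3,5,2]) (Split [1,4,2,3,5] (Split [1,4,2,5,3] (Over [0]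
    [3] [1,4,2,5]) (Split [1,4,5,2,3] (Over [0] [5] [1,4,2,3]) (Differ [0,2] [2,6,1] [5,3,4,7] [2,3,4]
    [1,5,6,7]))) (Under [0] [2] [1,4,3,5]))) (Under [0] [2] [1,3,5,4])) (Under [0] [1] [2,3,5,4]))))))))))
    (Under [0] [1] [3,2,4,5])))))))))))))) (Split [2,3,4,1,5] (Split [2,3,4,5,1] (Over [0,1] [] [2,3,4,5,1,6])
    (Split [2,4,1,5,3] (Over [0,1] [] [2,3,5,1,6,4]) (Split [1,3,4,5,2] (Over [0,1] [] [1,3,4,5,2,6]) (Split
    [4,2,3,5,1] (Over [0,1] [] [4,2,3,5,1,6]) (Split [3,4,2,5,1] (Over [0,1] [] [3,4,5,2,6,1]) (Split
    [3,2,4,1,5] (Over [0] [2] [3,4,1,5]) (Split [3,4,2,1,5] (Over [0] [2] [3,4,1,5]) (Split [3,4,1,2,5] (Over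
    [0] [2] [3,4,1,5]) (Split [2,4,3,1,5] (Over [0] [3] [2,4,1,5]) (Split [2,4,1,3,5] (Over [0] [3] [2,4,1,5])
    (Split [4,2,3,1,5] (Over [0] [4] [2,3,1,5]) (Split [2,3,5,4,1] (Over [0] [5] [2,3,4,1]) (Split [1,3,4,2,5]
    (Split [1,2,4,5,3] (Over [0,1] [] [1,2,4,5,3,6]) (Split [2,1,4,5,3] (Over [0,1] [] [2,1,4,5,3,6]) (Split
    [1,3,2,4,5] (Over [0] [2] [1,3,4,5]) (Split [1,4,2,3,5] (Over [0] [3] [1,4,2,5]) (Split [1,3,2,5,4] (Over
    [0] [4] [1,3,2,5]) (Split [1,3,5,4,2] (Over [0] [5] [1,3,4,2]) (Split [2,4,5,1,3] (Split [2,4,5,3,1] (Over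
    [0] [1] [2,4,5,3]) (Split [4,2,5,1,3] (Over [0] [2] [4,5,1,3]) (Split [2,4,3,5,1] (Over [0] [3] [2,4,5,1])
    (Split [2,3,5,1,4] (Split [1,2,3,5,4] (Over [0] [1] [2,3,5,4]) (Split [2,1,3,5,4] (Over [0] [1] [2,3,5,4])
    (Split [1,3,5,2,4] (Split [3,1,5,2,4] (Over [0] [1] [3,5,2,4]) (Split [1,2,4,3,5] (Split [3,1,2,5,4] (Over
    [0,1] [] [3,1,2,5,4,6]) (Split [2,1,4,3,5] (Over [0] [1] [2,4,3,5]) (Split [3,1,2,4,5] (Over [0] [3]
    [1,2,4,5]) (Split [4,1,2,3,5] (Over [0] [4] [1,2,3,5]) (Split [4,2,1,3,5] (Differ [0,2] [5,2,6] [1,3,4,7]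
    [2,4,6] [1,3,5,7]) (Under [0] [4] [2,1,3,5])))))) (Split [2,1,4,3,5] (Split [3,1,2,4,5] (Split [4,1,2,3,5]
    (Differ [0,2] [2,4,5] [1,3,6,7] [3,1,5] [2,4,6,7]) (Under [0] [4] [1,2,3,5])) (Under [0] [3] [1,2,4,5]))
    (Under [0] [1] [2,4,3,5])))) (Under [0] [2] [1,3,5,4])))) (Under [0] [4] [2,3,5,1]))))) (Split [2,4,5,3,1]
    (Split [4,2,5,3,1] (Over [0] [2] [4,5,3,1]) (Split [4,5,2,3,1] (Over [0] [2] [4,5,3,1]) (Split [5,4,2,3,1]
    (Split [5,2,4,1,3] (Over [0,1] [] [6,5,2,4,1,3]) (Split [2,5,4,1,3] (Over [0,1] [] [3,6,5,2,4,1]) (Under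
    [0] [5] [2,4,1,3]))) (Under [0] [5] [4,2,3,1])))) (Under [0] [1] [2,4,5,3]))))))))) (Split [3,1,4,2,5]
    (Split [1,3,2,4,5] (Over [0,1] [] [3,1,4,2,5,6]) (Under [0] [2] [1,3,4,5])) (Under [0] [1]
    [3,4,2,5]))))))))))))))) (Split [2,3,4,5,1] (Split [2,3,5,1,4] (Over [0,1] [] [2,3,4,6,1,5]) (Split
    [5,1,2,3,4] (Over [0,1] [] [6,2,3,4,5,1]) (Split [4,1,2,3,5] (Over [0,1] [] [5,2,3,4,6,1]) (Split
    [3,1,2,4,5] (Over [0,1] [] [4,2,3,5,6,1]) (Split [3,2,4,5,1] (Over [0] [2] [3,4,5,1]) (Split [2,4,3,5,1]
    (Over [0] [3] [2,4,5,1]) (Split [4,2,3,5,1] (Over [0] [4] [2,3,5,1]) (Split [2,3,5,4,1] (Over [0] [4]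
    [2,3,5,1]) (Split [1,2,3,5,4] (Split [1,2,4,3,5] (Over [0,1] [] [1,2,3,5,4,6]) (Split [2,3,1,5,4] (Over
    [0] [1] [2,3,5,4]) (Split [1,3,2,5,4] (Over [0] [2] [1,3,5,4]) (Split [1,4,2,3,5] (Over [0] [4] [1,2,3,5])
    (Split [4,2,1,3,5] (Split [2,1,4,5,3] (Over [0,1] [] [5,2,1,4,6,3]) (Split [4,2,3,1,5] (Over [0] [1]
    [4,2,3,5]) (Split [2,1,4,3,5] (Over [0] [4] [2,1,3,5]) (Split [2,4,3,1,5] (Split [3,2,1,4,5] (Over [0,1]
    [] [2,4,3,1,5,6]) (Under [0] [3] [2,1,4,5])) (Under [0] [4] [2,3,1,5]))))) (Split [4,2,3,1,5] (Split
    [2,4,1,5,3] (Over [0,1] [] [5,2,4,1,6,3]) (Split [2,4,3,1,5] (Over [0] [2] [4,3,1,5]) (Split [4,2,1,5,3]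
    (Over [0] [3] [4,2,1,5]) (Split [4,2,5,3,1] (Over [0] [5] [4,2,3,1]) (Split [2,1,4,3,5] (Split [1,3,2,4,5]
    (Over [0,1] [] [2,1,4,3,5,6]) (Split [1,4,2,5,3] (Over [0,1] [] [2,1,5,3,6,4]) (Split [1,4,3,2,5] (Over
    [0] [2] [1,4,3,5]) (Split [3,2,1,4,5] (Over [0] [3] [2,1,4,5]) (Split [1,2,4,5,3] (Split [1,3,4,2,5] (Over
    [0,1] [] [1,2,4,5,3,6]) (Split [3,1,4,2,5] (Split [4,1,3,2,5] (Split [4,5,1,3,2] (Over [0,1] []
    [4,5,1,3,2,6]) (Differ [0,2] [4,2,7] [3,1,6,5] [1,5,3] [2,4,6,7])) (Under [0] [4] [1,3,2,5])) (Under [0]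
    [3] [1,4,2,5]))) (Under [0] [3] [1,2,4,5])))))) (Split [2,4,1,3,5] (Split [4,1,2,5,3] (Over [0,1] []
    [2,5,1,3,6,4]) (Split [4,2,5,1,3] (Over [0,1] [] [4,2,5,1,3,6]) (Split [1,4,2,5,3] (Split [4,1,5,2,3]
    (Over [0,1] [] [1,5,2,6,3,4]) (Split [4,1,5,3,2] (Over [0,1] [] [1,5,2,6,4,3]) (Under [0] [2] [4,1,5,3])))
    (Under [0] [1] [4,2,5,3])))) (Under [0] [1] [2,4,3,5]))))))) (Under [0] [1] [4,2,3,5]))))))) (Split
    [2,1,3,5,4] (Split [1,2,4,3,5] (Over [0,1] [] [2,1,3,5,4,6]) (Split [1,2,5,3,4] (Over [0,1] []
    [2,1,3,6,4,5]) (Split [1,2,5,4,3] (Over [0,1] [] [2,1,3,6,5,4]) (Split [1,3,2,5,4] (Over [0] [2]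
    [1,3,5,4]) (Split [1,4,2,3,5] (Split [3,1,2,5,4] (Over [0,1] [] [1,4,2,3,6,5]) (Under [0] [3] [1,2,5,4]))
    (Under [0] [4] [1,2,3,5])))))) (Split [2,3,1,5,4] (Split [1,3,4,2,5] (Over [0,1] [] [1,3,4,2,6,5]) (Split
    [3,2,4,1,5] (Over [0,1] [] [3,2,4,1,6,5]) (Split [2,1,4,3,5] (Over [0,1] [] [2,3,1,5,4,6]) (Split
    [3,2,5,4,1] (Over [0,1] [] [3,4,2,6,5,1]) (Split [2,1,5,4,3] (Over [0,1] [] [2,3,1,6,5,4]) (Split
    [3,2,1,5,4] (Over [0] [2] [3,1,5,4]) (Split [3,1,2,5,4] (Over [0] [2] [3,1,5,4]) (Split [2,4,3,1,5] (Over
    [0] [4] [2,3,1,5]) (Split [1,2,4,3,5] (Split [1,3,2,4,5] (Over [0,1] [] [1,2,4,3,5,6]) (Split [1,3,2,5,4]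
    (Over [0,1] [] [1,2,4,3,6,5]) (Split [3,2,1,4,5] (Split [3,2,5,1,4] (Over [0] [5] [3,2,1,4]) (Under [0]
    [1] [3,2,5,4])) (Under [0] [1] [3,2,4,5])))) (Split [2,4,1,3,5] (Split [1,4,2,3,5] (Split [1,3,5,2,4]
    (Over [0,1] [] [1,3,5,2,4,6]) (Split [3,2,5,1,4] (Over [0,1] [] [3,2,5,1,4,6]) (Split [1,2,5,3,4] (Over
    [0,1] [] [1,2,5,3,4,6]) (Split [1,4,3,2,5] (Over [0] [2] [1,4,3,5]) (Split [1,4,3,5,2] (Over [0] [2]
    [1,4,3,5]) (Split [1,3,2,5,4] (Split [1,5,2,3,4] (Split [1,2,5,4,3] (Over [0] [3] [1,2,5,4]) (Split
    [1,3,2,4,5] (Over [0] [4] [1,3,2,5]) (Split [1,5,2,4,3] (Over [0] [3] [1,5,2,4]) (Differ [0,2] [3,4,1]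
    [2,6,5,7] [2,3,6] [1,5,4,7])))) (Under [0] [5] [1,2,3,4])) (Under [0] [1] [3,2,5,4]))))))) (Under [0] [4]
    [1,2,3,5])) (Under [0] [1] [2,4,3,5]))))))))))) (Under [0] [1] [2,3,5,4])))))))))))) (Under [0] [1]
    [2,3,4,5])))))"

definition refutation_length_5_density_2 :: refutation where
  "refutation_length_5_density_2 =
    Split [1,2,3,4,5] (Over [0,1] [] [1,2,3,4,5,6]) (Split [2,1,3,4,5] (Split [1,2,3,5,4] (Over [0,1] []
    [2,1,3,4,6,5]) (Split [2,3,4,5,1] (Over [0,1] [] [3,2,4,5,6,1]) (Split [1,2,4,5,3] (Over [0,1] []
    [2,1,3,5,6,4]) (Split [1,3,2,4,5] (Over [0,1] [] [1,3,2,4,5,6]) (Split [1,3,4,5,2] (Over [0,1] []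
    [2,1,4,5,6,3]) (Split [4,2,1,3,5] (Over [0,1] [] [4,2,1,3,5,6]) (Split [2,3,1,4,5] (Over [0,1] []
    [2,3,1,4,5,6]) (Split [3,1,2,4,5] (Split [1,2,4,3,5] (Split [1,3,4,2,5] (Split [2,3,4,1,5] (Split
    [2,4,1,3,5] (Over [0,1] [] [2,4,1,3,5,6]) (Split [1,4,2,3,5] (Over [0,1] [] [1,4,2,3,5,6]) (Split
    [5,3,1,2,4] (Over [0,1] [] [5,3,1,2,4,6]) (Split [1,3,2,5,4] (Over [0,1] [] [1,2,4,3,6,5]) (Split
    [1,4,3,5,2] (Over [0,1] [] [1,2,5,4,6,3]) (Split [3,1,2,5,4] (Over [0,1] [] [3,1,2,5,4,6]) (Split
    [2,1,3,5,4] (Over [0,1] [] [2,1,3,5,4,6]) (Split [3,1,4,5,2] (Over [0,1] [] [3,1,4,5,2,6]) (Split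
    [2,3,1,5,4] (Over [0,1] [] [1,3,4,2,6,5]) (Split [4,2,3,5,1] (Over [0,1] [] [4,2,3,5,1,6]) (Split
    [4,1,2,3,5] (Split [1,3,5,2,4] (Split [1,3,5,4,2] (Split [2,1,4,3,5] (Split [1,4,5,2,3] (Split [2,3,5,1,4]
    (Split [3,5,1,2,4] (Over [0,1] [] [3,5,1,2,4,6]) (Split [2,5,1,3,4] (Over [0,1] [] [2,5,1,3,4,6]) (Split
    [2,5,3,1,4] (Over [0,1] [] [1,3,6,4,2,5]) (Split [3,1,5,2,4] (Differ [0,2] [1,4,6] [2,3,5,7] [2,6,3]
    [1,4,5,7]) (Under [0] [5] [3,1,2,4]))))) (Under [0] [1] [2,3,5,4])) (Under [0] [3] [1,4,5,2])) (Under [0]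
    [4] [2,1,3,5])) (Under [0] [2] [1,3,5,4])) (Under [0] [2] [1,3,5,4])) (Under [0] [4] [1,2,3,5]))))))))))))
    (Under [0] [1] [2,3,4,5])) (Under [0] [2] [1,3,4,5])) (Under [0] [3] [1,2,4,5])) (Under [0] [3]
    [1,2,4,5]))))))))) (Split [2,3,1,4,5] (Split [2,3,4,1,5] (Over [0,1] [] [2,3,4,1,5,6]) (Split [1,3,4,2,5]
    (Over [0,1] [] [1,3,4,2,5,6]) (Split [4,2,3,1,5] (Over [0,1] [] [4,2,3,1,5,6]) (Split [3,1,4,5,2] (Over
    [0,1] [] [2,4,1,5,6,3]) (Split [3,2,4,1,5] (Over [0,1] [] [3,2,4,1,5,6]) (Split [3,2,4,5,1] (Over [0,1] []
    [3,4,2,5,6,1]) (Split [2,3,4,5,1] (Split [1,3,2,4,5] (Split [3,4,5,1,2] (Over [0,1] [] [2,4,5,6,1,3])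
    (Split [3,4,5,2,1] (Over [0,1] [] [3,4,5,6,2,1]) (Split [4,1,2,3,5] (Over [0,1] [] [5,2,3,4,6,1]) (Split
    [3,1,2,4,5] (Over [0,1] [] [4,2,3,5,6,1]) (Split [1,2,4,3,5] (Over [0,1] [] [1,2,4,3,5,6]) (Split
    [4,1,3,2,5] (Over [0,1] [] [4,1,3,2,5,6]) (Split [3,1,4,2,5] (Over [0,1] [] [3,1,4,2,5,6]) (Split
    [3,4,1,5,2] (Split [3,2,1,4,5] (Split [1,2,4,5,3] (Split [1,4,2,3,5] (Split [1,2,3,5,4] (Split [4,1,5,2,3]
    (Over [0,1] [] [3,5,1,6,2,4]) (Split [4,1,5,3,2] (Over [0,1] [] [4,5,1,6,3,2]) (Split [2,4,3,1,5] (Over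
    [0,1] [] [2,4,3,1,5,6]) (Split [1,4,3,2,5] (Over [0,1] [] [1,4,3,2,5,6]) (Split [1,4,5,3,2] (Over [0,1] []
    [1,2,5,6,4,3]) (Split [4,1,2,5,3] (Over [0,1] [] [1,5,2,3,6,4]) (Split [4,1,3,5,2] (Over [0,1] []
    [1,5,2,4,6,3]) (Split [3,1,2,5,4] (Over [0,1] [] [1,4,2,3,6,5]) (Split [1,3,5,4,2] (Over [0,1] []
    [1,2,4,6,5,3]) (Split [2,3,1,5,4] (Split [1,4,2,5,3] (Split [4,5,1,2,3] (Differ [0,2] [1,4,5] [2,3,6,7]
    [4,6,3] [1,2,5,7]) (Under [0] [5] [4,1,2,3])) (Under [0] [3] [1,4,2,5])) (Under [0] [4]
    [2,3,1,5]))))))))))) (Under [0] [4] [1,2,3,5])) (Under [0] [4] [1,2,3,5])) (Under [0] [3] [1,2,4,5]))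
    (Under [0] [1] [3,2,4,5])) (Under [0] [1] [3,4,5,2]))))))))) (Under [0] [2] [1,3,4,5])) (Under [0] [1]
    [2,3,4,5])))))))) (Split [2,3,4,1,5] (Split [2,3,4,5,1] (Over [0,1] [] [2,3,4,5,1,6]) (Under [0] [1]
    [2,3,4,5])) (Under [0] [1] [2,3,4,5]))))"

text \<open>The class is that of 1234, hence the initial positive word; 2 and 3 are the counts
  \<open>N 1\<close> and \<open>N 2\<close>. The shapes of the second list have lengths 2 and 3, on
  which the statistic is already trivial.\<close>

lemma refutes_length_4:
  "refutes 4 [(([0], 1, 3), 2), (([0], 2, 2), 3)] [([0, 1], 2, 3), ([0, 2], 3, 3)] [[1, 2, 3, 4]] []
    refutation_length_4"
  by code_simp

text \<open>Shuffling with the empty word yields only the word itself, so the count 0 says that no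
  word of length 6 has both its windows of length 5 in the class. The shape with offsets 0 and 2
  concerns words of length 7.\<close>

lemma refutes_length_5_density_2:
  "refutes 5 [(([0], 1, 4), 2), (([0, 1], 0, 6), 0)] [([0, 2], 3, 4)] [] [] refutation_length_5_density_2"
  by code_simp

lemma refutes_length_5_density_1:
  "refutes 5 [(([0], 1, 4), 1), (([0, 1], 0, 6), 0)] [([0, 2], 3, 4)] [] [] refutation_length_5_density_1"
  by code_simp


section \<open>Counting the words of a class in a shuffle\<close>

definition sum_shuf :: "('a list \<Rightarrow> nat) \<Rightarrow> 'a list \<Rightarrow> 'a list \<Rightarrow> nat" where
  "sum_shuf F u w = sum_list (map F (shuf u w))"

lemma sum_shuf_Nil [simp]: "sum_shuf F [] = F" "sum_shuf F u [] = F u"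
  by (simp_all add: sum_shuf_def fun_eq_iff) (cases u; simp)

lemma sum_shuf_Cons:
  "sum_shuf F (x # u) (y # w) = sum_shuf (\<lambda>t. F (x # t)) u (y # w) + sum_shuf (\<lambda>t. F (y # t)) (x # u) w"
  by (simp add: sum_shuf_def o_def)

lemma sum_shuf_add: "sum_shuf (\<lambda>t. F t + G t) u w = sum_shuf F u w + sum_shuf G u w"
  by (simp add: sum_shuf_def sum_list_addf)

text \<open>Both sides sum \<open>F\<close> over the shuffles of three words. The first letter of
  such a shuffle comes from \<open>u\<close>, \<open>a\<close> or \<open>b\<close>; splitting it off
  gives three smaller instances, in which \<open>F\<close> is applied after prefixing that
  letter.\<close>

lemma sum_shuf_assoc:
  "sum_shuf (\<lambda>v. sum_shuf F u v) a b = sum_shuf (\<lambda>v. sum_shuf F v b) u a"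
proof (induction "length u + length a + length b" arbitrary: F u a b rule: less_induct)
  case less
  show ?case
  proof (cases "u = [] \<or> a = [] \<or> b = []")
    case True
    then show ?thesis by auto
  next
    case False
    then obtain x u' y a' z b' where eq: "u = x # u'" "a = y # a'" "b = z # b'"
      by (metis neq_Nil_conv)
    have "sum_shuf (\<lambda>v. sum_shuf F u v) a b =
        sum_shuf (\<lambda>v. sum_shuf (\<lambda>t. F (x # t)) u' v) a b +
        sum_shuf (\<lambda>v. sum_shuf (\<lambda>t. F (y # t)) u v) a' b +
        sum_shuf (\<lambda>v. sum_shuf (\<lambda>t. F (z # t)) u v) a b'"
      unfolding eq by (simp add: sum_shuf_Cons sum_shuf_add)
    also have "\<dots> = sum_shuf (\<lambda>v. sum_shuf (\<lambda>t. F (x # t)) v b) u' a +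
        sum_shuf (\<lambda>v. sum_shuf (\<lambda>t. F (y # t)) v b) u a' +
        sum_shuf (\<lambda>v. sum_shuf (\<lambda>t. F (z # t)) v b') u a"
      by (simp add: less eq)
    also have "\<dots> = sum_shuf (\<lambda>v. sum_shuf F v b) u a"
      unfolding eq by (simp add: sum_shuf_Cons sum_shuf_add)
    finally show ?thesis .
  qed
qed

lemma sum_shuf_const: "sum_shuf (\<lambda>_. c) u w = length (shuf u w) * c"
  by (simp add: sum_shuf_def sum_list_triv)

lemma sum_shuf_cong: "(\<And>\<tau>. \<tau> \<in> shuffles u w \<Longrightarrow> F \<tau> = G \<tau>) \<Longrightarrow> sum_shuf F u w = sum_shuf G u w"
  unfolding sum_shuf_def by (metis (no_types, lifting) map_eq_conv set_shuf)

lemma sum_shuf_mono: "(\<And>\<tau>. \<tau> \<in> shuffles u w \<Longrightarrow> F \<tau> \<le> G \<tau>) \<Longrightarrow> sum_shuf F u w \<le> sum_shuf G u w"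
  unfolding sum_shuf_def by (rule sum_list_mono) (simp add: set_shuf)

lemma sum_list_map_le_eq:
  fixes F G :: "'a \<Rightarrow> nat"
  assumes "\<And>x. x \<in> set xs \<Longrightarrow> F x \<le> G x" "sum_list (map F xs) = sum_list (map G xs)" "x \<in> set xs"
  shows "F x = G x"
  using assms
proof (induction xs)
  case (Cons y xs)
  have "sum_list (map F xs) \<le> sum_list (map G xs)" by (rule sum_list_mono) (use Cons in simp)
  moreover have "F y \<le> G y" using Cons by simp
  ultimately have "F y = G y" "sum_list (map F xs) = sum_list (map G xs)"
    using Cons.prems(2) by simp_all
  then show ?case using Cons by auto
qed simp

text \<open>Turns an extremal count into a statement about every single shuffle.\<close>

lemma sum_shuf_le_eq:
  assumes "\<And>\<tau>. \<tau> \<in> shuffles u w \<Longrightarrow> F \<tau> \<le> G \<tau>" "sum_shuf F u w = sum_shuf G u w" "\<tau> \<in> shuffles u w"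
  shows "F \<tau> = G \<tau>"
  using sum_list_map_le_eq[of "shuf u w" F G \<tau>] assms by (simp add: sum_shuf_def set_shuf)

lemma length_shuf_single: "length (shuf [x] w) = Suc (length w)"
  by (induction w) simp_all

lemma sum_list_of_bool_filter: "sum_list (map (\<lambda>x. of_bool (P x)) xs) = length (filter P xs)"
  by (induction xs) simp_all

section \<open>Soundness of the case trees\<close>

definition hits :: "(nat list \<Rightarrow> bool) \<Rightarrow> nat \<Rightarrow> nat list \<Rightarrow> nat list \<Rightarrow> nat" where
  "hits C n ks \<tau> = of_bool (\<forall>k\<in>set ks. C (take n (drop k \<tau>)))"

lemma length_standardize [simp]: "length (standardize w) = length w"
  by (simp add: standardize_def)

text \<open>The number of smaller letters grows strictly from a letter of \<open>w\<close> to a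
  larger one, since the former is then counted itself.\<close>

lemma same_relative_order_standardize: "same_relative_order (standardize w) w"
proof -
  have "length (filter (\<lambda>y. y < a) w) < length (filter (\<lambda>y. y < b) w) \<longleftrightarrow> a < b" if "a \<in> set w" for a b
  proof
    assume "length (filter (\<lambda>y. y < a) w) < length (filter (\<lambda>y. y < b) w)"
    moreover have "length (filter (\<lambda>y. y < b) w) \<le> length (filter (\<lambda>y. y < a) w)" if "b \<le> a"
      by (induction w) (use that in auto)
    ultimately show "a < b" by (meson leD not_le)
  next
    assume "a < b"
    have le: "length (filter (\<lambda>y. y < a) v) \<le> length (filter (\<lambda>y. y < b) v)" for v
      by (induction v) (use \<open>a < b\<close> in auto)
    from that show "length (filter (\<lambda>y. y < a) w) < length (filter (\<lambda>y. y < b) w)"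
    proof (induction w)
      case (Cons x w)
      then show ?case using \<open>a < b\<close> le[of w] by (cases "x = a") (auto simp: less_Suc_eq_le)
    qed simp
  qed
  then show ?thesis by (simp add: same_relative_order_def standardize_def)
qed

lemma is_permutation_standardize:
  assumes "is_permutation w"
  shows "is_permutation (standardize w)"
proof -
  have "standardize w ! i \<noteq> standardize w ! j" if "i < length w" "j < length w" "i \<noteq> j" for i j
  proof -
    have "w ! i \<noteq> w ! j" using that assms by (simp add: is_permutation_def nth_eq_iff_index_eq)
    then show ?thesis
      using same_relative_order_standardize[of w] that unfolding same_relative_order_def
      by (metis length_standardize linorder_neqE_nat nat_neq_iff)
  qed
  then have "distinct (standardize w)" by (simp add: distinct_conv_nth)
  then show ?thesis by (auto simp: is_permutation_def standardize_def)
qed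

text \<open>At each \<open>Split\<close>, membership in the actual class selects the branch to
  follow. At a leaf the true count lies between \<open>lower_bound\<close> and
  \<open>upper_bound\<close>, which contradicts the value in \<open>K\<close> or the equality given
  by \<open>D\<close>.\<close>

lemma refutes_sound:
  assumes inv: "\<And>w. is_permutation w \<Longrightarrow> C (standardize w) \<longleftrightarrow> C w"
    and K: "\<And>ks a b c u w. map_of K (ks, a, b) = Some c \<Longrightarrow> is_permutation (u @ w) \<Longrightarrow>
      length u = a \<Longrightarrow> length w = b \<Longrightarrow> sum_shuf (hits C n ks) u w = c"
    and D: "\<And>ks a b u w u' w'. (ks, a, b) \<in> set D \<Longrightarrow> is_permutation (u @ w) \<Longrightarrow> is_permutation (u' @ w') \<Longrightarrow>
      length u = a \<Longrightarrow> length w = b \<Longrightarrow> length u' = a \<Longrightarrow> length w' = b \<Longrightarrow>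
      sum_shuf (hits C n ks) u w = sum_shuf (hits C n ks) u' w'"
    and "refutes n K D pos neg r" "\<forall>w\<in>set pos. C w" "\<forall>w\<in>set neg. \<not> C w"
  shows False
  using assms(4-6)
proof (induction r arbitrary: pos neg)
  case (Split w r s)
  then show ?case
    using Split.IH(1)[of "w # pos" neg] Split.IH(2)[of pos "w # neg"] by (cases "C w") simp_all
next
  have bounds: "lower_bound pos (map (windows n ks) (shuf u w)) \<le> sum_shuf (hits C n ks) u w"
    "sum_shuf (hits C n ks) u w \<le> upper_bound neg (map (windows n ks) (shuf u w))"
    if "is_permutation (u @ w)" "\<forall>w\<in>set pos. C w" "\<forall>w\<in>set neg. \<not> C w" for pos neg ks u w
  proof -
    have "C (standardize (take n (drop k \<tau>))) \<longleftrightarrow> C (take n (drop k \<tau>))" if "\<tau> \<in> set (shuf u w)" for k \<tau>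
    proof -
      have "is_permutation \<tau>"
        using shuffles_permutation(1)[of u w \<tau>] \<open>is_permutation (u @ w)\<close> that
        by (simp add: disjoint_perms_append set_shuf)
      then show ?thesis by (intro inv is_permutation_take is_permutation_drop)
    qed
    then have weight: "sum_shuf (hits C n ks) u w = sum_list (map (\<lambda>\<tau>. of_bool (list_all C (windows n ks \<tau>))) (shuf u w))"
      unfolding hits_def sum_shuf_def
      by (intro arg_cong[of _ _ sum_list] map_cong) (auto simp: windows_def list_all_iff)
    have lower: "lower_bound pos (map (windows n ks) (shuf u w)) =
        sum_list (map (\<lambda>\<tau>. of_bool (list_all (\<lambda>w. w \<in> set pos) (windows n ks \<tau>))) (shuf u w))"
      unfolding sum_list_of_bool_filter by (simp add: lower_bound_def filter_map o_def)
    have upper: "upper_bound neg (map (windows n ks) (shuf u w)) =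
        sum_list (map (\<lambda>\<tau>. of_bool (list_all (\<lambda>w. w \<notin> set neg) (windows n ks \<tau>))) (shuf u w))"
      unfolding sum_list_of_bool_filter by (simp add: upper_bound_def filter_map o_def)
    show "lower_bound pos (map (windows n ks) (shuf u w)) \<le> sum_shuf (hits C n ks) u w"
      unfolding weight lower by (rule sum_list_mono) (use that in \<open>auto simp: list_all_iff\<close>)
    show "sum_shuf (hits C n ks) u w \<le> upper_bound neg (map (windows n ks) (shuf u w))"
      unfolding weight upper by (rule sum_list_mono) (use that in \<open>auto simp: list_all_iff\<close>)
  qed
  {
    case (Over ks u w)
    then obtain c where "map_of K (ks, length u, length w) = Some c" "is_permutation (u @ w)"
      "c < lower_bound pos (map (windows n ks) (shuf u w))"
      by (auto split: option.splits)
    then show ?case using K[of ks "length u" "length w" c u w] bounds(1)[of u w pos neg ks] Over by simp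
  next
    case (Under ks u w)
    then obtain c where "map_of K (ks, length u, length w) = Some c" "is_permutation (u @ w)"
      "upper_bound neg (map (windows n ks) (shuf u w)) < c"
      by (auto split: option.splits)
    then show ?case using K[of ks "length u" "length w" c u w] bounds(2)[of u w pos neg ks] Under by simp
  next
    case (Differ ks u w u' w')
    then have r: "is_permutation (u @ w)" "is_permutation (u' @ w')" "length u = length u'" "length w = length w'"
      "(ks, length u, length w) \<in> set D"
      "upper_bound neg (map (windows n ks) (shuf u' w')) < lower_bound pos (map (windows n ks) (shuf u w))"
      unfolding refutes.simps by blast+
    have "sum_shuf (hits C n ks) u w = sum_shuf (hits C n ks) u' w'"
      by (rule D[OF r(5,1,2) refl refl r(3,4)[symmetric]])
    then show ?case
      using r(6) bounds(1)[OF r(1) Differ(2,3), of ks] bounds(2)[OF r(2) Differ(2,3), of ks] by linarith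
  }
qed

section \<open>Uniform counts and their consequences\<close>

definition uniform :: "(nat list \<Rightarrow> nat) \<Rightarrow> nat \<Rightarrow> nat \<Rightarrow> nat \<Rightarrow> bool" where
  "uniform F a b c \<longleftrightarrow>
    (\<forall>u w. is_permutation (u @ w) \<longrightarrow> length u = a \<longrightarrow> length w = b \<longrightarrow> sum_shuf F u w = c)"

lemma uniformD:
  "uniform F a b c \<Longrightarrow> is_permutation (u @ w) \<Longrightarrow> length u = a \<Longrightarrow> length w = b \<Longrightarrow> sum_shuf F u w = c"
  unfolding uniform_def by blast

text \<open>The sum of \<open>F\<close> over all shuffles of \<open>u\<close>, \<open>a\<close> and
  \<open>b\<close>, computed twice: shuffling \<open>a\<close> with \<open>b\<close> first gives the
  left side, \<open>u\<close> with \<open>a\<close> first the right side.\<close>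

lemma uniform_double_count:
  assumes "uniform F (length u) (length a + length b) p" "uniform F (length u + length a) (length b) q"
    and perm: "is_permutation (u @ a @ b)"
  shows "length (shuf a b) * p = length (shuf u a) * q"
proof -
  have "sum_shuf F u v = p" if "v \<in> shuffles a b" for v
  proof (rule uniformD[OF assms(1)])
    have "disjoint_perms a b" using perm by (auto simp: disjoint_perms_append is_permutation_def)
    then show "is_permutation (u @ v)" "length v = length a + length b"
      using shuffles_permutation[of a b v] that set_shuffles[OF that] perm by (auto simp: is_permutation_def)
  qed simp
  then have p: "sum_shuf (\<lambda>v. sum_shuf F u v) a b = length (shuf a b) * p"
    unfolding sum_shuf_const[symmetric] by (rule sum_shuf_cong)
  have "sum_shuf F v b = q" if "v \<in> shuffles u a" for v
  proof (rule uniformD[OF assms(2)])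
    have "disjoint_perms u a" using perm by (auto simp: disjoint_perms_append is_permutation_def)
    then show "is_permutation (v @ b)" "length v = length u + length a"
      using shuffles_permutation[of u a v] that set_shuffles[OF that] perm by (auto simp: is_permutation_def)
  qed simp
  then have q: "sum_shuf (\<lambda>v. sum_shuf F v b) u a = length (shuf u a) * q"
    unfolding sum_shuf_const[symmetric] by (rule sum_shuf_cong)
  show ?thesis using sum_shuf_assoc[of F u a b] p q by simp
qed

lemma append_in_shuffles: "u @ w \<in> shuffles u w"
  by (induction u) (auto simp: Cons_in_shuffles_rightI Cons_in_shuffles_leftI)

lemma sum_hits_0:
  assumes "is_permutation (u @ w)" "length u + length w = n"
  shows "sum_shuf (hits C n [0]) u w = sum_shuf (\<lambda>\<tau>. of_bool (C \<tau>)) u w"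
  by (rule sum_shuf_cong)
    (use assms shuffles_permutation(2)[of u w] in \<open>simp add: hits_def disjoint_perms_append\<close>)

context bicompatible_statistic
begin

definition in_class :: "'a \<Rightarrow> nat list \<Rightarrow> bool" where
  "in_class \<alpha> w \<longleftrightarrow> st w = \<alpha>"

lemma in_class_standardize: "is_permutation w \<Longrightarrow> in_class \<alpha> (standardize w) \<longleftrightarrow> in_class \<alpha> w"
  using st_order[OF is_permutation_standardize _ same_relative_order_standardize] by (simp add: in_class_def)

text \<open>Substring compatibility makes the indicator of the windows a function of
  \<open>st\<close>, so shuffle compatibility applies to it.\<close>

lemma sum_hits_eq:
  assumes "is_permutation (u @ w)" "is_permutation (u' @ w')" "st u = st u'" "st w = st w'"
    "length u = length u'" "length w = length w'" "\<forall>k\<in>set ks. k + n \<le> length u + length w"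
  shows "sum_shuf (hits (in_class \<alpha>) n ks) u w = sum_shuf (hits (in_class \<alpha>) n ks) u' w'"
proof -
  have "determines (length u + length w) (hits (in_class \<alpha>) n ks)"
    unfolding determines_def
  proof (intro allI impI)
    fix \<pi> \<sigma> :: "nat list"
    assume *: "is_permutation \<pi>" "is_permutation \<sigma>" "length \<pi> = length u + length w"
      "length \<sigma> = length u + length w" "st \<pi> = st \<sigma>"
    have "in_class \<alpha> (take n (drop k \<pi>)) \<longleftrightarrow> in_class \<alpha> (take n (drop k \<sigma>))" if "k \<in> set ks" for k
      using st_window[OF *(1,2) _ *(5), of k n] *(3,4) assms(7) that by (simp add: in_class_def)
    then show "hits (in_class \<alpha>) n ks \<pi> = hits (in_class \<alpha>) n ks \<sigma>"
      by (simp add: hits_def)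
  qed
  then have "mset (map (hits (in_class \<alpha>) n ks) (shuf u w)) = mset (map (hits (in_class \<alpha>) n ks) (shuf u' w'))"
    using assms(1-6) by (intro shuf_st_image) (simp_all only: disjoint_perms_append)
  then show ?thesis unfolding sum_shuf_def by (metis sum_mset_sum_list)
qed

text \<open>With all words of each of the two lengths equivalent, any two pairs of words have the
  same count by \<open>sum_hits_eq\<close>.\<close>

lemma uniform_hits:
  assumes "trivial_on a" "trivial_on b" "\<forall>k\<in>set ks. k + n \<le> a + b"
  shows "\<exists>c. uniform (hits (in_class \<alpha>) n ks) a b c"
proof (cases "\<exists>u w. is_permutation (u @ w) \<and> length u = a \<and> length w = b")
  case True
  then obtain u w where uw: "is_permutation (u @ w)" "length u = a" "length w = b" by blast
  have "sum_shuf (hits (in_class \<alpha>) n ks) u' w' = sum_shuf (hits (in_class \<alpha>) n ks) u w"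
    if "is_permutation (u' @ w')" "length u' = a" "length w' = b" for u' w'
  proof (rule sum_hits_eq)
    have "is_permutation u" "is_permutation w" "is_permutation u'" "is_permutation w'"
      using uw that by (auto simp: is_permutation_def)
    then show "st u' = st u" "st w' = st w"
      using uw that trivial_onD[OF assms(1), of u' u] trivial_onD[OF assms(2), of w' w] by auto
  qed (use uw that assms(3) in simp_all)
  then show ?thesis unfolding uniform_def by blast
next
  case False
  then show ?thesis unfolding uniform_def by blast
qed

abbreviation member :: "'a \<Rightarrow> nat list \<Rightarrow> nat" where
  "member \<alpha> \<tau> \<equiv> of_bool (in_class \<alpha> \<tau>)"

lemma uniform_member:
  assumes "trivial_on a" "trivial_on b"
  shows "\<exists>c. uniform (member \<alpha>) a b c"
proof -
  obtain c where "uniform (hits (in_class \<alpha>) (a + b) [0]) a b c"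
    using uniform_hits[OF assms] by fastforce
  then have "uniform (member \<alpha>) a b c"
    unfolding uniform_def by (auto simp flip: sum_hits_0[of _ _ "a + b"])
  then show ?thesis by blast
qed

lemma trivial_on_0: "trivial_on 0"
  by (simp add: trivial_on_def)

lemma trivial_on_1: "trivial_on 1"
  unfolding trivial_on_def
proof (intro allI impI)
  fix \<pi> \<sigma> :: "nat list"
  assume *: "is_permutation \<pi>" "is_permutation \<sigma>" "length \<pi> = 1" "length \<sigma> = 1"
  then obtain x y where "\<pi> = [x]" "\<sigma> = [y]" by (auto simp: length_Suc_conv)
  then show "st \<pi> = st \<sigma>" using * st_single[of x y] by (simp add: is_permutation_def)
qed

text \<open>Every word is a shuffle of its first letter with its tail, and all \<open>Suc m\<close>
  such shuffles are in the class.\<close>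

lemma trivial_on_if_full:
  assumes "uniform (member \<alpha>) 1 m (Suc m)"
  shows "trivial_on (Suc m)"
proof -
  have "st \<pi> = \<alpha>" if perm: "is_permutation \<pi>" and len: "length \<pi> = Suc m" for \<pi>
  proof -
    from len obtain x v where \<pi>: "\<pi> = x # v" "length v = m" by (auto simp: length_Suc_conv)
    have "sum_shuf (member \<alpha>) [x] v = Suc m"
      by (rule uniformD[OF assms]) (use perm \<pi> in simp_all)
    then have eq: "sum_shuf (member \<alpha>) [x] v = sum_shuf (\<lambda>_. 1) [x] v"
      by (simp add: sum_shuf_const length_shuf_single \<pi>)
    have "member \<alpha> \<pi> = 1"
      by (rule sum_shuf_le_eq[OF _ eq]) (simp_all add: \<pi> shuffles_Cons)
    then show ?thesis by (simp add: in_class_def of_bool_def split: if_splits)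
  qed
  then show ?thesis unfolding trivial_on_def by metis
qed

text \<open>The member \<open>w\<close> is one of the shuffles of its first letter with its tail, so
  the count is not zero.\<close>

lemma uniform_member_bounds:
  assumes "uniform (member \<alpha>) 1 m c" "is_permutation w" "length w = Suc m" "in_class \<alpha> w"
  shows "0 < c" "c \<le> Suc m"
proof -
  from assms(3) obtain x v where w: "w = x # v" "length v = m" by (auto simp: length_Suc_conv)
  have c: "sum_shuf (member \<alpha>) [x] v = c"
    by (rule uniformD[OF assms(1)]) (use assms w in simp_all)
  have "sum_shuf (member \<alpha>) [x] v \<le> sum_shuf (\<lambda>_. 1) [x] v" by (rule sum_shuf_mono) simp
  then show "c \<le> Suc m" using c by (simp add: sum_shuf_const length_shuf_single w)
  show "0 < c"
  proof (rule ccontr)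
    assume "\<not> 0 < c"
    then have eq: "sum_shuf (\<lambda>_. 0) [x] v = sum_shuf (member \<alpha>) [x] v"
      using c by (simp add: sum_shuf_const)
    have "0 = member \<alpha> w"
      by (rule sum_shuf_le_eq[OF _ eq]) (simp_all add: w shuffles_Cons)
    then show False using assms(4) by simp
  qed
qed

section \<open>Length four\<close>

lemma trivial_on_4:
  assumes "trivial_on 2" "trivial_on 3"
  shows "trivial_on 4"
proof (rule ccontr)
  assume nontrivial: "\<not> trivial_on 4"
  define \<alpha> where "\<alpha> = st [1, 2, 3, 4]"
  obtain p where p: "uniform (member \<alpha>) 1 3 p" using uniform_member[OF trivial_on_1 assms(2)] by blast
  obtain q where q: "uniform (member \<alpha>) 2 2 q" using uniform_member[OF assms(1,1)] by blast
  have "3 * p = 2 * q"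
    using uniform_double_count[of "member \<alpha>" "[1]" "[2]" "[3, 4]" p q] p q
    by (simp add: is_permutation_def numeral_eq_Suc)
  moreover have "p \<noteq> 4" using trivial_on_if_full[of \<alpha> 3] p nontrivial by auto
  moreover have "0 < p" "p \<le> Suc 3"
    using uniform_member_bounds[OF p, of "[1, 2, 3, 4]"]
    by (simp_all add: is_permutation_def in_class_def \<alpha>_def)
  \<comment> \<open>\<open>3 * p = 2 * q\<close> makes \<open>p\<close> even, and with
    \<open>p = 4\<close> the class would be everything.\<close>
  ultimately have "p = 2" "q = 3" by presburger+
  show False
  proof (rule refutes_sound[where C = "in_class \<alpha>", OF in_class_standardize _ _ refutes_length_4])
    fix ks u w :: "nat list" and a b c :: nat
    assume K: "map_of [(([0], 1, 3), 2), (([0], 2, 2), 3)] (ks, a, b) = Some c"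
      and uw: "is_permutation (u @ w)" "length u = a" "length w = b"
    from K consider "ks = [0]" "a = 1" "b = 3" "c = 2" | "ks = [0]" "a = 2" "b = 2" "c = 3"
      by (auto split: if_splits)
    then show "sum_shuf (hits (in_class \<alpha>) 4 ks) u w = c"
      by cases (use uniformD[OF p uw(1)] uniformD[OF q uw(1)] uw \<open>p = 2\<close> \<open>q = 3\<close> in \<open>simp_all add: sum_hits_0\<close>)
  next
    fix ks u w u' w' :: "nat list" and a b :: nat
    assume D: "(ks, a, b) \<in> set [([0, 1], 2, 3), ([0, 2], 3, 3)]"
      and uw: "is_permutation (u @ w)" "is_permutation (u' @ w')" "length u = a" "length w = b"
        "length u' = a" "length w' = b"
    from D have "trivial_on a" "trivial_on b" "\<forall>k\<in>set ks. k + 4 \<le> a + b" using assms by auto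
    then show "sum_shuf (hits (in_class \<alpha>) 4 ks) u w = sum_shuf (hits (in_class \<alpha>) 4 ks) u' w'"
      using uniform_hits uw unfolding uniform_def by metis
  qed (simp_all add: in_class_def \<alpha>_def)
qed

section \<open>Length five\<close>

text \<open>Place behind \<open>v\<close> a copy of \<open>w\<close> raised above the letters of
  \<open>v\<close>. Sliding the window of length \<open>n\<close> from this copy leftwards to
  \<open>v\<close> never leaves the class.\<close>

lemma trivial_on_if_left_closed:
  assumes w: "is_permutation w" "length w = n" "in_class \<alpha> w"
    and closed: "\<And>\<tau>. is_permutation \<tau> \<Longrightarrow> length \<tau> = Suc n \<Longrightarrow> in_class \<alpha> (drop 1 \<tau>) \<Longrightarrow> in_class \<alpha> (take n \<tau>)"
  shows "trivial_on n"
proof -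
  have "st v = \<alpha>" if v: "is_permutation v" "length v = n" for v
  proof -
    define w' where "w' = map (\<lambda>x. x + above v) w"
    have w': "is_permutation w'" "length w' = n"
      using w by (auto simp: w'_def is_permutation_def distinct_map inj_on_def)
    have "st w' = st w"
      unfolding w'_def by (rule st_order) (use w w'[unfolded w'_def] in \<open>auto intro: same_relative_order_map\<close>)
    have "set v \<inter> set w' = {}"
      using above_greater[of _ v] by (fastforce simp: w'_def)
    then have \<rho>: "is_permutation (v @ w')" using v w' by (auto simp: is_permutation_def)
    have "in_class \<alpha> (take n (drop (n - k) (v @ w')))" if "k \<le> n" for k
      using that
    proof (induction k)
      case 0
      then show ?case using v w' w \<open>st w' = st w\<close> by (simp add: in_class_def)
    next
      case (Suc k)
      let ?\<tau> = "take (Suc n) (drop (n - Suc k) (v @ w'))"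
      have "drop 1 (take (Suc n) (drop j r)) = take n (drop (Suc j) r)" for j and r :: "nat list"
        by (simp add: drop_take)
      from this[of "n - Suc k"] have "drop 1 ?\<tau> = take n (drop (n - k) (v @ w'))"
        using Suc.prems by (simp only: Suc_diff_Suc Suc_le_eq)
      then have "in_class \<alpha> (take n ?\<tau>)"
        by (intro closed is_permutation_take is_permutation_drop \<rho>) (use Suc v w' in simp_all)
      then show ?case by (simp only: take_take min.absorb1 le_SucI order_refl)
    qed
    from this[of n] show ?thesis using v by (simp add: in_class_def)
  qed
  then show ?thesis unfolding trivial_on_def by metis
qed

text \<open>All letters are equivalent, so by \<open>sum_hits_eq\<close> only the class of
  \<open>v\<close> matters for the count.\<close>

lemma sum_hits_class:
  assumes "\<forall>k\<in>set ks. k + n \<le> Suc m"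
  shows "\<exists>s. \<forall>x v. is_permutation (x # v) \<longrightarrow> length v = m \<longrightarrow> in_class \<gamma> v \<longrightarrow>
    sum_shuf (hits (in_class \<alpha>) n ks) [x] v = s"
proof (cases "\<exists>x v. is_permutation (x # v) \<and> length v = m \<and> in_class \<gamma> v")
  case True
  then obtain x v where xv: "is_permutation (x # v)" "length v = m" "in_class \<gamma> v" by blast
  have "sum_shuf (hits (in_class \<alpha>) n ks) [y] v' = sum_shuf (hits (in_class \<alpha>) n ks) [x] v"
    if "is_permutation (y # v')" "length v' = m" "in_class \<gamma> v'" for y v'
    by (rule sum_hits_eq) (use xv that assms st_single[of y x] in \<open>simp_all add: in_class_def is_permutation_Cons\<close>)
  then show ?thesis by blast
next
  case False
  then show ?thesis by blast
qed

text \<open>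
  Let \<open>p\<close> of the five words in each shuffle of a letter with a word of length 4 lie in the class \<open>\<alpha>\<close>,
  and call a word of length 6 double if both its windows of length 5 do. The number of double words in the
  shuffles of words of lengths 2 and 4 is a multiple of 3 and at most \<open>3 * p\<close>; equality means that the class
  is closed under shifting the window to the left.
\<close>

lemma no_double_hit_length_6:
  assumes triv: "\<And>m. m \<le> 4 \<Longrightarrow> trivial_on m" and nontrivial: "\<not> trivial_on 5"
    and p: "uniform (member \<alpha>) 1 4 p"
    and p_cases: "p = 1 \<or> p = 2 \<and> (\<forall>v. is_permutation v \<longrightarrow> length v = 5 \<longrightarrow> in_class \<alpha> v \<or> in_class \<beta> v)"
    and w0: "is_permutation w0" "length w0 = 5" "in_class \<alpha> w0"
    and \<tau>: "is_permutation \<tau>" "length \<tau> = 6"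
  shows "hits (in_class \<alpha>) 5 [0, 1] \<tau> = 0"
proof -
  \<comment> \<open>\<open>?h\<close> marks the double words and \<open>?g\<close> the words whose
    second window is in the class, so \<open>?h\<close> is at most \<open>?g\<close> on words of
    length 6.\<close>
  let ?h = "hits (in_class \<alpha>) 5 [0, 1]"
  let ?g = "\<lambda>\<tau>. member \<alpha> (drop 1 \<tau>)"
  have h: "?h \<tau> = of_bool (in_class \<alpha> (take 5 \<tau>) \<and> in_class \<alpha> (drop 1 \<tau>))" if "length \<tau> = 6" for \<tau>
    using that by (simp add: hits_def)
  have le: "?h \<tau> \<le> ?g \<tau>" if "length \<tau> = 6" for \<tau>
    using h[OF that] by simp
  \<comment> \<open>Pointwise equality would be the closure property in
    \<open>trivial_on_if_left_closed\<close>.\<close>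
  have not_closed: "\<not> (\<forall>\<tau>. is_permutation \<tau> \<longrightarrow> length \<tau> = 6 \<longrightarrow> ?h \<tau> = ?g \<tau>)"
  proof
    assume eq: "\<forall>\<tau>. is_permutation \<tau> \<longrightarrow> length \<tau> = 6 \<longrightarrow> ?h \<tau> = ?g \<tau>"
    have "trivial_on 5"
    proof (rule trivial_on_if_left_closed[OF w0])
      fix \<tau> assume \<tau>: "is_permutation \<tau>" "length \<tau> = Suc 5" "in_class \<alpha> (drop 1 \<tau>)"
      then have len: "length \<tau> = 6" by simp
      have "?h \<tau> = 1" using eq[rule_format, OF \<tau>(1) len] \<tau>(3) by (simp only: of_bool_eq)
      then show "in_class \<alpha> (take 5 \<tau>)" unfolding h[OF len] by (cases "in_class \<alpha> (take 5 \<tau>)") simp_all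
    qed
    then show False using nontrivial by simp
  qed
  obtain q where q: "uniform (member \<alpha>) 2 3 q" using uniform_member[of 2 3] triv by auto
  obtain A where A: "uniform ?h 2 4 A" using uniform_hits[of 2 4 "[0, 1]" 5] triv by auto
  obtain B where B: "uniform ?h 3 3 B" using uniform_hits[of 3 3 "[0, 1]" 5] triv by auto
  have "4 * p = 2 * q"
    using uniform_double_count[of "member \<alpha>" "[1]" "[2]" "[3, 4, 5]" p q] p q
    by (simp add: is_permutation_def numeral_eq_Suc)
  then have "q = 2 * p" by simp
  \<comment> \<open>Shuffles of three words of lengths 2, 1 and 3, counted twice; the equation makes
    \<open>A\<close> a multiple of 3.\<close>
  have "4 * A = 3 * B"
    using uniform_double_count[of ?h "[1, 2]" "[3]" "[4, 5, 6]" A B] A B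
    by (simp add: is_permutation_def numeral_eq_Suc)
  have len: "length \<tau> = 6" if "\<tau> \<in> shuffles u w" "length u + length w = 6" for \<tau> u w
    using that length_shuffles by metis
  \<comment> \<open>Removing the first letter of a shuffle leaves a shuffle of words of lengths 1
    and 4 or of lengths 2 and 3, with counts \<open>p\<close> and \<open>q = 2 * p\<close>.\<close>
  have g: "sum_shuf ?g u w = 3 * p" if uw: "is_permutation (u @ w)" "length u = 2" "length w = 4" for u w
  proof -
    obtain a u' b w' where eq: "u = a # u'" "w = b # w'"
      using uw by (metis length_0_conv neq_Nil_conv zero_neq_numeral)
    have "sum_shuf (member \<alpha>) u' w = p"
      by (rule uniformD[OF p]) (use uw eq in \<open>auto simp: is_permutation_def\<close>)
    moreover have "sum_shuf (member \<alpha>) u w' = q"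
      by (rule uniformD[OF q]) (use uw eq in \<open>auto simp: is_permutation_def\<close>)
    ultimately show ?thesis using \<open>q = 2 * p\<close> unfolding eq by (simp add: sum_shuf_Cons)
  qed
  have split: "is_permutation (take 2 \<tau> @ drop 2 \<tau>)" "length (take 2 \<tau>) = 2" "length (drop 2 \<tau>) = 4"
    "\<tau> \<in> shuffles (take 2 \<tau>) (drop 2 \<tau>)" if "is_permutation \<tau>" "length \<tau> = 6" for \<tau>
    using that append_in_shuffles[of "take 2 \<tau>" "drop 2 \<tau>"] by simp_all
  have "A \<le> 3 * p"
    using sum_shuf_mono[of "take 2 \<tau>" "drop 2 \<tau>" ?h ?g] le len split[OF \<tau>] g[of "take 2 \<tau>" "drop 2 \<tau>"]
      uniformD[OF A split(1-3)[OF \<tau>]] by (metis \<tau>(2) append_take_drop_id length_append)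
  moreover have "A \<noteq> 3 * p"
  proof
    assume eq: "A = 3 * p"
    have "?h \<tau> = ?g \<tau>" if \<tau>: "is_permutation \<tau>" "length \<tau> = 6" for \<tau>
    proof (rule sum_shuf_le_eq[OF _ _ split(4)[OF \<tau>]])
      show "?h \<tau>' \<le> ?g \<tau>'" if "\<tau>' \<in> shuffles (take 2 \<tau>) (drop 2 \<tau>)" for \<tau>'
        using le len[OF that] \<tau> by simp
      show "sum_shuf ?h (take 2 \<tau>) (drop 2 \<tau>) = sum_shuf ?g (take 2 \<tau>) (drop 2 \<tau>)"
        using g[OF split(1-3)[OF \<tau>]] uniformD[OF A split(1-3)[OF \<tau>]] eq by simp
    qed
    then show False using not_closed by blast
  qed
  moreover have "p = 1 \<or> p = 2" using p_cases by blast
  \<comment> \<open>\<open>A\<close> is a multiple of 3 below \<open>3 * p\<close>: it is 0 if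
    \<open>p = 1\<close>, and 0 or 3 if \<open>p = 2\<close>.\<close>
  ultimately have "A = 0 \<or> A = 3 \<and> p = 2"
    using \<open>4 * A = 3 * B\<close> by presburger
  then show ?thesis
  proof
    assume "A = 0"
    then have eq: "sum_shuf (\<lambda>_. 0) (take 2 \<tau>) (drop 2 \<tau>) = sum_shuf ?h (take 2 \<tau>) (drop 2 \<tau>)"
      using uniformD[OF A split(1-3)[OF \<tau>]] by (simp add: sum_shuf_const)
    show ?thesis by (rule sum_shuf_le_eq[OF _ eq split(4)[OF \<tau>], symmetric]) simp
  next
    assume *: "A = 3 \<and> p = 2"
    then have \<beta>: "in_class \<alpha> v \<or> in_class \<beta> v" if "is_permutation v" "length v = 5" for v
      using p_cases that by auto
    \<comment> \<open>\<open>s1\<close> counts the double words among the shuffles of a letter with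
      a word of class \<alpha>; \<open>s0\<close> does the same for \<beta>.\<close>
    obtain s1 where s1: "\<And>x v. is_permutation (x # v) \<Longrightarrow> length v = 5 \<Longrightarrow> in_class \<alpha> v \<Longrightarrow> sum_shuf ?h [x] v = s1"
      using sum_hits_class[of "[0, 1]" 5 5 \<alpha> \<alpha>] by auto
    obtain s0 where s0: "\<And>x v. is_permutation (x # v) \<Longrightarrow> length v = 5 \<Longrightarrow> in_class \<beta> v \<Longrightarrow> sum_shuf ?h [x] v = s0"
      using sum_hits_class[of "[0, 1]" 5 5 \<beta> \<alpha>] by auto
    \<comment> \<open>Double words among the shuffles of 1, 2 and 3456 are counted twice: of the
      five words \<open>v\<close>, two lie in \<alpha> and three in \<beta>, so
      \<open>2 * s1 + 3 * s0\<close> equals \<open>2 * A = 6\<close>. The term with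
      \<open>s0\<close> is added on the left to avoid subtraction.\<close>
    have "sum_shuf (\<lambda>v. sum_shuf ?h [1] v + s0 * member \<alpha> v) [2] [3, 4, 5, 6] =
      sum_shuf (\<lambda>v. s1 * member \<alpha> v + s0) [2] [3, 4, 5, 6]"
    proof (rule sum_shuf_cong)
      fix v :: "nat list" assume "v \<in> shuffles [2] [3, 4, 5, 6]"
      then have v: "is_permutation (1 # v)" "is_permutation v" "length v = 5"
        by (auto simp: is_permutation_def)
      show "sum_shuf ?h [1] v + s0 * member \<alpha> v = s1 * member \<alpha> v + s0"
        using s1[OF v(1,3)] s0[OF v(1,3)] \<beta>[OF v(2,3)] by (cases "in_class \<alpha> v") simp_all
    qed
    moreover have "sum_shuf (\<lambda>v. c * member \<alpha> v) [2] [3, 4, 5, 6] = c * p" for c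
    proof -
      have "sum_shuf (\<lambda>v. c * member \<alpha> v) [2] [3, 4, 5, 6] = c * sum_shuf (member \<alpha>) [2] [3, 4, 5, 6]"
        by (simp only: sum_shuf_def sum_list_const_mult)
      also have "sum_shuf (member \<alpha>) [2] [3, 4, 5, 6] = p"
        by (rule uniformD[OF p]) (simp_all add: is_permutation_def)
      finally show ?thesis .
    qed
    moreover have "sum_shuf (\<lambda>v. sum_shuf ?h [1] v) [2] [3, 4, 5, 6] = 2 * A"
    proof -
      have "sum_shuf (\<lambda>v. sum_shuf ?h v [3, 4, 5, 6]) [1] [2] = sum_shuf (\<lambda>_. A) [1::nat] [2]"
        by (rule sum_shuf_cong, rule uniformD[OF A]) (auto simp: is_permutation_def)
      then show ?thesis by (simp add: sum_shuf_assoc sum_shuf_const)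
    qed
    ultimately have "2 * A + s0 * p = s1 * p + 5 * s0"
      by (simp only: sum_shuf_add sum_shuf_const length_shuf_single) simp
    then have "6 = 2 * s1 + 3 * s0" using * by simp
    then have "s1 = 0 \<or> s1 = 3" by presburger
    then show ?thesis
    proof
      assume "s1 = 0"
      obtain x v where xv: "\<tau> = x # v" "length v = 5" using \<tau>(2) by (auto simp: length_Suc_conv numeral_eq_Suc)
      show ?thesis
      proof (cases "in_class \<alpha> v")
        case True
        then have eq: "sum_shuf (\<lambda>_. 0) [x] v = sum_shuf ?h [x] v"
          using s1[of x v] xv \<tau> \<open>s1 = 0\<close> by (simp add: sum_shuf_const)
        show ?thesis by (rule sum_shuf_le_eq[OF _ eq, symmetric]) (simp_all add: xv shuffles_Cons)
      next
        case False
        then show ?thesis using h[OF \<tau>(2)] xv by simp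
      qed
    next
      assume "s1 = 3"
      \<comment> \<open>If the tail is in the class, \<open>?g\<close> sums to 1, for the new letter
        in front, plus \<open>p = 2\<close>, for the new letter elsewhere. This is
        \<open>s1\<close>, so \<open>?h\<close> and \<open>?g\<close> agree on each shuffle.\<close>
      have "?h \<tau> = ?g \<tau>" if \<tau>: "is_permutation \<tau>" "length \<tau> = 6" for \<tau>
      proof -
        obtain x y v where xv: "\<tau> = x # y # v" "length v = 4" using \<tau>(2) by (auto simp: length_Suc_conv numeral_eq_Suc)
        show ?thesis
        proof (cases "in_class \<alpha> (y # v)")
          case True
          have "sum_shuf ?g [x] (y # v) = member \<alpha> (y # v) + sum_shuf (member \<alpha>) [x] v"
            by (simp add: sum_shuf_Cons)
          also have "sum_shuf (member \<alpha>) [x] v = p"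
            by (rule uniformD[OF p]) (use \<tau> xv in \<open>auto simp: is_permutation_def\<close>)
          finally have eq: "sum_shuf ?h [x] (y # v) = sum_shuf ?g [x] (y # v)"
            using s1[of x "y # v"] \<tau> xv True \<open>s1 = 3\<close> * by simp
          show ?thesis
            by (rule sum_shuf_le_eq[OF _ eq]) (use le len[of _ "[x]" "y # v"] xv in \<open>simp_all add: shuffles_Cons\<close>)
        next
          case False
          then show ?thesis using h[OF \<tau>(2)] xv by simp
        qed
      qed
      then show ?thesis using not_closed by blast
    qed
  qed
qed

text \<open>If no value occurs exactly once, every multiplicity is at least 2; five places then hold
  just two distinct values, with multiplicities 2 and 3.\<close>

lemma ex_rare_value:
  assumes "length xs = 5" "\<not> (\<exists>\<alpha>. set xs = {\<alpha>})"
  shows "\<exists>\<alpha> \<beta>. count_list xs \<alpha> = 1 \<or> count_list xs \<alpha> = 2 \<and> set xs = {\<alpha>, \<beta>}"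
proof (cases "\<exists>\<alpha>. count_list xs \<alpha> = 1")
  case False
  have sum: "(\<Sum>\<alpha>\<in>set xs. count_list xs \<alpha>) = 5" using assms(1) sum_count_set[of xs "set xs"] by simp
  have two: "2 \<le> count_list xs \<alpha>" if "\<alpha> \<in> set xs" for \<alpha>
    using that False count_list_0_iff[of xs \<alpha>] by (metis One_nat_def Suc_leI le_neq_implies_less not_gr_zero numeral_2_eq_2)
  have "2 * card (set xs) \<le> 5" using sum_mono[of "set xs" "\<lambda>_. 2" "count_list xs"] two sum by simp
  moreover have "card (set xs) \<noteq> 0" using assms(1) by auto
  moreover have "card (set xs) \<noteq> 1" using assms(2) by (simp add: card_1_singleton_iff)
  ultimately have "card (set xs) = 2" by linarith
  then obtain \<alpha> \<beta> where ab: "set xs = {\<alpha>, \<beta>}" "\<alpha> \<noteq> \<beta>" by (auto simp: card_2_iff)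
  then have "count_list xs \<alpha> + count_list xs \<beta> = 5" using sum by simp
  moreover have "2 \<le> count_list xs \<alpha>" "2 \<le> count_list xs \<beta>" using two ab by auto
  ultimately have "count_list xs \<alpha> = 2 \<or> count_list xs \<beta> = 2" by linarith
  then show ?thesis using ab by (metis insert_commute)
qed blast

lemma trivial_on_5:
  assumes triv: "\<And>m. m \<le> 4 \<Longrightarrow> trivial_on m"
  shows "trivial_on 5"
proof (rule ccontr)
  assume nontrivial: "\<not> trivial_on 5"
  \<comment> \<open>Since lengths 1 and 4 are trivial, every shuffle of a letter with a word of
    length 4 has this list of values up to order; hence every value on words of length 5 occurs in
    it.\<close>
  define xs where "xs = map st (shuf [1] [2, 3, 4, 5])"
  have st_values: "mset (map st (shuf [x] v)) = mset xs" if "is_permutation (x # v)" "length v = 4" for x v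
    unfolding xs_def
  proof (rule shuf_st_image)
    show "st [x] = st [1]" "st v = st [2, 3, 4, 5]"
      using that st_single[of x 1] trivial_onD[OF triv[of 4], of v "[2, 3, 4, 5]"]
      by (simp_all add: is_permutation_def)
  qed (use that in \<open>simp_all add: disjoint_perms_append determines_st is_permutation_def\<close>)
  have in_xs: "st v \<in> set xs" if "is_permutation v" "length v = 5" for v
  proof -
    obtain x u where v: "v = x # u" "length u = 4" using \<open>length v = 5\<close> by (cases v) auto
    have "set (map st (shuf [x] u)) = set xs"
      by (rule mset_eq_setD[OF st_values]) (use that v in simp_all)
    then show ?thesis using shuffles_Cons[of x u] v set_shuf[of "[x]" u] by (metis imageI set_map)
  qed
  have "set xs \<noteq> {\<alpha>}" for \<alpha>
    using in_xs nontrivial unfolding trivial_on_def by (metis singletonD)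
  \<comment> \<open>Taking a rare value as the class gives \<open>p = 1\<close> or
    \<open>p = 2\<close>, and for \<open>p = 2\<close> all remaining words form the single class
    \<beta>.\<close>
  then obtain \<alpha> \<beta> where ab: "count_list xs \<alpha> = 1 \<or> count_list xs \<alpha> = 2 \<and> set xs = {\<alpha>, \<beta>}"
    using ex_rare_value[of xs] by (auto simp: xs_def)
  define p where "p = count_list xs \<alpha>"
  have count: "count_list (map st zs) \<alpha> = sum_list (map (member \<alpha>) zs)" for zs
    by (induction zs) (auto simp: in_class_def)
  have p: "uniform (member \<alpha>) 1 4 p"
    unfolding uniform_def
  proof (intro allI impI)
    fix u w assume *: "is_permutation (u @ w)" "length u = 1" "length w = 4"
    then obtain x where u: "u = [x]" by (auto simp: length_Suc_conv)
    show "sum_shuf (member \<alpha>) u w = p"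
      unfolding sum_shuf_def count[symmetric] p_def u
      using st_values[of x w] * u by (metis append_Cons append_Nil count_mset)
  qed
  have "\<alpha> \<in> set xs" using ab count_list_0_iff[of xs \<alpha>] by auto
  then obtain w0 where w0: "w0 \<in> shuffles [1] [2, 3, 4, 5]" "in_class \<alpha> w0"
    by (auto simp: xs_def in_class_def simp flip: set_shuf)
  have perm_w0: "is_permutation w0" "length w0 = 5"
    using shuffles_permutation[OF _ w0(1)] by (simp_all add: disjoint_perms_append is_permutation_def)
  have "hits (in_class \<alpha>) 5 [0, 1] \<tau> = 0" if "is_permutation \<tau>" "length \<tau> = 6" for \<tau>
  proof (rule no_double_hit_length_6[OF triv nontrivial p _ perm_w0 w0(2) that])
    show "p = 1 \<or> p = 2 \<and> (\<forall>v. is_permutation v \<longrightarrow> length v = 5 \<longrightarrow> in_class \<alpha> v \<or> in_class \<beta> v)"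
      using ab in_xs by (auto simp: p_def in_class_def)
  qed
  note zero = this
  \<comment> \<open>One tree refutes each value of \<open>p\<close>. The fact \<open>zero\<close>
    supplies the count for the empty first word, and \<open>D\<close> holds because lengths 3 and 4
    are trivial.\<close>
  have False if r: "refutes 5 [(([0], 1, 4), p), (([0, 1], 0, 6), 0)] [([0, 2], 3, 4)] [] [] r" for r
  proof (rule refutes_sound[where C = "in_class \<alpha>", OF in_class_standardize _ _ r])
    fix ks u w :: "nat list" and a b c :: nat
    assume K: "map_of [(([0], 1, 4), p), (([0, 1], 0, 6), 0)] (ks, a, b) = Some c"
      and uw: "is_permutation (u @ w)" "length u = a" "length w = b"
    from K consider "ks = [0]" "a = 1" "b = 4" "c = p" | "ks = [0, 1]" "a = 0" "b = 6" "c = 0"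
      by (auto split: if_splits)
    then show "sum_shuf (hits (in_class \<alpha>) 5 ks) u w = c"
      by cases (use uniformD[OF p uw(1)] zero[of w] uw in \<open>simp_all add: sum_hits_0\<close>)
  next
    fix ks u w u' w' :: "nat list" and a b :: nat
    assume D: "(ks, a, b) \<in> set [([0, 2], 3, 4)]"
      and uw: "is_permutation (u @ w)" "is_permutation (u' @ w')" "length u = a" "length w = b"
        "length u' = a" "length w' = b"
    from D have "trivial_on a" "trivial_on b" "\<forall>k\<in>set ks. k + 5 \<le> a + b" using triv by auto
    then show "sum_shuf (hits (in_class \<alpha>) 5 ks) u w = sum_shuf (hits (in_class \<alpha>) 5 ks) u' w'"
      using uniform_hits uw unfolding uniform_def by metis
  qed simp_all
  then show False
    using ab refutes_length_5_density_1 refutes_length_5_density_2 unfolding p_def by metis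
qed

section \<open>Length six\<close>

lemma trivial_on_6:
  assumes "\<And>m. m \<le> 5 \<Longrightarrow> trivial_on m"
  shows "trivial_on 6"
proof -
  define \<alpha> where "\<alpha> = st [1, 2, 3, 4, 5, 6]"
  obtain p where p: "uniform (member \<alpha>) 1 5 p" using uniform_member assms by (metis le_refl one_le_numeral)
  obtain q where q: "uniform (member \<alpha>) 2 4 q" using uniform_member[of 2 4] assms by auto
  obtain r where r: "uniform (member \<alpha>) 3 3 r" using uniform_member[of 3 3] assms by auto
  have "5 * p = 2 * q"
    using uniform_double_count[of "member \<alpha>" "[1]" "[2]" "[3, 4, 5, 6]" p q] p q
    by (simp add: is_permutation_def numeral_eq_Suc)
  moreover have "10 * p = 3 * r"
    using uniform_double_count[of "member \<alpha>" "[1]" "[2, 3]" "[4, 5, 6]" p r] p r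
    by (simp add: is_permutation_def numeral_eq_Suc)
  moreover have "0 < p" "p \<le> Suc 5"
    using uniform_member_bounds[OF p, of "[1, 2, 3, 4, 5, 6]"]
    by (simp_all add: is_permutation_def in_class_def \<alpha>_def)
  \<comment> \<open>The first equation makes \<open>p\<close> even, the second a multiple of
    3.\<close>
  ultimately have "p = 6" by presburger
  then show ?thesis using trivial_on_if_full[of \<alpha> 5] p by simp
qed

end

section \<open>The classification by separation in lengths two and three\<close>

theorem theorem4p2:
  fixes st :: "nat list \<Rightarrow> 'a"
  assumes "permutation_statistic st" and "bicompatible st"
  shows "st_equiv st Des \<or> st_equiv st Pk \<or> st_equiv st Val \<or>
    (\<forall>\<pi> \<sigma>. is_permutation \<pi> \<longrightarrow> is_permutation \<sigma> \<longrightarrow> length \<pi> = length \<sigma> \<longrightarrow> length \<sigma> \<le> 6 \<longrightarrow>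
      st_sim st \<pi> \<sigma>)"
proof -
  interpret bicompatible_statistic st using assms by unfold_locales
  consider "st_equiv st Des" | "st_equiv st Pk" | "st_equiv st Val"
    | "st [1, 2] = st [2, 1]" "\<not> st_equiv st Pk" "\<not> st_equiv st Val"
    using st_equiv_Des by blast
  then show ?thesis
  proof cases
    case 4
    \<comment> \<open>Lengths 0 and 1 are trivial for every statistic; from length 2 on, triviality
      climbs one length at a time.\<close>
    have "trivial_on m" if "m \<le> 4" for m
    proof -
      have "trivial_on 2" "trivial_on 3" "trivial_on 4"
        using trivial_on_2[OF 4(1)] trivial_on_3[OF 4] trivial_on_4 by blast+
      moreover have "m = 0 \<or> m = 1 \<or> m = 2 \<or> m = 3 \<or> m = 4" using that by linarith
      ultimately show ?thesis using trivial_on_0 trivial_on_1 by blast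
    qed
    then have "trivial_on m" if "m \<le> 5" for m
      using that trivial_on_5 by (cases "m = 5") simp_all
    then have "trivial_on m" if "m \<le> 6" for m
      using that trivial_on_6 by (cases "m = 6") simp_all
    then show ?thesis unfolding trivial_on_def st_sim_def by blast
  qed simp_all
qed

end
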